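(* Let $(M,\varphi,\xi,\eta,g)$ be a $(2n+1)$-dimensional Einstein-like Sasaki-like almost contact B-metric manifold. If it admits a Ricci-like soliton with potential $v$ (an arbitrary vector field), then the Ricci tensor of $g$ is $\rho=2n\,\eta\otimes\eta$ and the scalar curvatures $\tau$ of $g$ and $\tilde\tau$ of the associated B-metric $\tilde g$ are $\tau=\tilde\tau=2n$.
   Context: An almost contact B-metric manifold $(M,\varphi,\xi,\eta,g)$ is a differentiable manifold $M$ of dimension $2n+1$ with an endomorphism $\varphi$ of $TM$, a vector field $\xi$ (Reeb vector field), a 1-form $\eta$ and a pseudo-Riemannian metric $g$ of signature $(n+1,n)$ such that $\varphi\xi=0$, $\varphi^2=-\mathrm{id}+\eta\otimes\xi$, $\eta\circ\varphi=0$, $\eta(\xi)=1$ and $g(\varphi x,\varphi y)=-g(x,y)+\eta(x)\eta(y)$ for all vector fields $x,y$. The associated B-metric is $\tilde g(x,y)=g(x,\varphi y)+\eta(x)\eta(y)$. The manifold is called Sasaki-like if, with $\nabla$ the Levi-Civita connection of $g$, $(\nabla_x\varphi)y=-g(x,y)\xi-\eta(y)x+2\eta(x)\eta(y)\xi$ for all $x,y$. The curvature tensor is $R(x,y)z=\nabla_x\nabla_y z-\nabla_y\nabla_x z-\nabla_{[x,y]}z$, $R(x,y,z,w)=g(R(x,y)z,w)$; the Ricci tensor of $g$ is $\rho(y,z)=g^{ij}R(e_i,y,z,e_j)$ for any local basis $\{e_i\}$, $\tau=g^{ij}\rho(e_i,e_j)$ is the scalar curvature of $g$, and $\tilde\tau$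 is the scalar curvature of the metric $\tilde g$ (computed from the curvature tensor of the Levi-Civita connection of $\tilde g$ and traced with $\tilde g$). The manifold is Einstein-like if $\rho=a\,g+b\,\tilde g+c\,\eta\otimes\eta$ for some real constants $(a,b,c)$. The manifold admits a Ricci-like soliton with potential vector field $v$ if there are real constants $(\lambda,\mu,\nu)$ with $\tfrac12\mathcal{L}_v g+\rho+\lambda\, g+\mu\,\tilde g+\nu\,\eta\otimes\eta=0$, where $\mathcal{L}$ is the Lie derivative. *)

theory Defs
  imports "HOL-Analysis.Analysis"
begin

section \<open>Smooth functions on open subsets of Euclidean space\<close>

primrec Ck_on :: "nat \<Rightarrow> ('a::euclidean_space \<Rightarrow> 'b::real_normed_vector) \<Rightarrow> 'a set \<Rightarrow> bool" where
  "Ck_on 0 f S \<longleftrightarrow> continuous_on S f"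
| "Ck_on (Suc k) f S \<longleftrightarrow>
     (\<forall>x\<in>S. f differentiable (at x)) \<and>
     (\<forall>v. Ck_on k (\<lambda>x. frechet_derivative f (at x) v) S)"

text \<open>The two-sided derivative is used, so this is meant for open \<open>S\<close> only.\<close>

definition smooth_on :: "('a::euclidean_space \<Rightarrow> 'b::real_normed_vector) \<Rightarrow> 'a set \<Rightarrow> bool" where
  "smooth_on f S \<longleftrightarrow> (\<forall>k. Ck_on k f S)"


section \<open>Smooth manifolds\<close>

text \<open>
  The manifold is the whole type \<open>'m\<close>, its smooth structure is generated by a (not
  necessarily maximal) atlas of charts \<open>(V, x)\<close>, where only the values of \<open>x\<close> on \<open>V\<close> matter.
  Its dimension is \<open>CARD('d)\<close>.
\<close>

type_synonym ('m, 'd) atlas = "('m set \<times> ('m \<Rightarrow> real^'d)) set"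

definition smooth_atlas ::
    "('m::{t2_space, second_countable_topology}, 'd::finite) atlas \<Rightarrow> bool" where
  "smooth_atlas A \<longleftrightarrow>
     (\<Union>(V, x)\<in>A. V) = UNIV \<and>
     (\<forall>(V, x)\<in>A. open V \<and> open (x ` V) \<and> (\<exists>y. homeomorphism V (x ` V) x y)) \<and>
     (\<forall>(V, x)\<in>A. \<forall>(W, y)\<in>A. smooth_on (y \<circ> inv_into V x) (x ` (V \<inter> W)))"

text \<open>
  Functions, vector fields and tensor fields on an open set \<open>U\<close> are total functions on \<open>'m\<close>
  whose values outside \<open>U\<close> are irrelevant.
\<close>

definition smooth_funs ::
    "('m::topological_space, 'd::finite) atlas \<Rightarrow> 'm set \<Rightarrow> ('m \<Rightarrow> real) set" where
  "smooth_funs A U = {f. \<forall>(V, x)\<in>A. smooth_on (f \<circ> inv_into V x) (x ` (U \<inter> V))}"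

definition smooth_at ::
    "('m::topological_space, 'd::finite) atlas \<Rightarrow> 'm \<Rightarrow> ('m \<Rightarrow> real) \<Rightarrow> bool" where
  "smooth_at A p f \<longleftrightarrow> (\<exists>U. open U \<and> p \<in> U \<and> f \<in> smooth_funs A U)"


section \<open>Tangent vectors and vector fields\<close>

text \<open>
  Tangent vectors are operators on functions. The type of all operators
  \<open>('m \<Rightarrow> real) \<Rightarrow> real\<close> is wrapped up only to make it a real vector space with
  the pointwise operations; \<open>dir v f\<close> is the derivative of \<open>f\<close> along \<open>v\<close>.
\<close>

typedef 'm tvec = "UNIV :: (('m \<Rightarrow> real) \<Rightarrow> real) set"
  morphisms dir Tvec
  by simp

instantiation tvec :: (type) real_vector
begin

definition "0 = Tvec (\<lambda>f. 0)"
definition "v + w = Tvec (\<lambda>f. dir v f + dir w f)"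
definition "- v = Tvec (\<lambda>f. - dir v f)"
definition "v - w = Tvec (\<lambda>f. dir v f - dir w f)"
definition "c *\<^sub>R v = Tvec (\<lambda>f. c * dir v f)"

instance
  by standard
    (simp_all add: zero_tvec_def plus_tvec_def uminus_tvec_def minus_tvec_def scaleR_tvec_def
      Tvec_inverse dir_inverse algebra_simps)

end

text \<open>
  The tangent space at \<open>p\<close> consists of the directional derivatives
  \<open>\<Sum>\<^sub>i w\<^sub>i \<partial>/\<partial>x\<^sub>i\<close> in the coordinates of a chart around \<open>p\<close>. They act on functions that are
  smooth near \<open>p\<close> and are set to zero on all others, so that two tangent vectors are equal
  iff they agree on the functions smooth near \<open>p\<close>; by the chain rule the choice of the chart
  does not matter.
\<close>

definition coord_vec ::
    "('m::topological_space, 'd::finite) atlas \<Rightarrow> 'm set \<times> ('m \<Rightarrow> real^'d) \<Rightarrow> 'm \<Rightarrow> real^'d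
      \<Rightarrow> 'm tvec" where
  "coord_vec A c p w = (case c of (V, x) \<Rightarrow>
     Tvec (\<lambda>f. if smooth_at A p f
               then frechet_derivative (f \<circ> inv_into V x) (at (x p)) w else 0))"

definition tangent_space ::
    "('m::topological_space, 'd::finite) atlas \<Rightarrow> 'm \<Rightarrow> 'm tvec set" where
  "tangent_space A p = {coord_vec A (V, x) p w | V x w. (V, x) \<in> A \<and> p \<in> V}"

type_synonym 'm vfield = "'m \<Rightarrow> 'm tvec"

definition vfields ::
    "('m::topological_space, 'd::finite) atlas \<Rightarrow> 'm set \<Rightarrow> 'm vfield set" where
  "vfields A U = {X. (\<forall>p\<in>U. X p \<in> tangent_space A p) \<and>
     (\<forall>V f. open V \<and> V \<subseteq> U \<and> f \<in> smooth_funs A V \<longrightarrow> (\<lambda>p. dir (X p) f) \<in> smooth_funs A V)}"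

definition lie_bracket ::
    "('m::topological_space, 'd::finite) atlas \<Rightarrow> 'm vfield \<Rightarrow> 'm vfield \<Rightarrow> 'm vfield" where
  "lie_bracket A X Y p =
     Tvec (\<lambda>f. if smooth_at A p f
               then dir (X p) (\<lambda>q. dir (Y q) f) - dir (Y p) (\<lambda>q. dir (X q) f) else 0)"


section \<open>Tensor fields\<close>

definition one_form ::
    "('m::topological_space, 'd::finite) atlas \<Rightarrow> ('m \<Rightarrow> 'm tvec \<Rightarrow> real) \<Rightarrow> bool" where
  "one_form A \<eta> \<longleftrightarrow>
     (\<forall>p. \<forall>x\<in>tangent_space A p. \<forall>y\<in>tangent_space A p. \<forall>c.
        \<eta> p (x + y) = \<eta> p x + \<eta> p y \<and> \<eta> p (c *\<^sub>R x) = c * \<eta> p x) \<and>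
     (\<forall>U. open U \<longrightarrow> (\<forall>X\<in>vfields A U. (\<lambda>p. \<eta> p (X p)) \<in> smooth_funs A U))"

definition endo_field ::
    "('m::topological_space, 'd::finite) atlas \<Rightarrow> ('m \<Rightarrow> 'm tvec \<Rightarrow> 'm tvec) \<Rightarrow> bool" where
  "endo_field A \<phi> \<longleftrightarrow>
     (\<forall>p. \<forall>x\<in>tangent_space A p. \<forall>y\<in>tangent_space A p. \<forall>c.
        \<phi> p x \<in> tangent_space A p \<and>
        \<phi> p (x + y) = \<phi> p x + \<phi> p y \<and> \<phi> p (c *\<^sub>R x) = c *\<^sub>R \<phi> p x) \<and>
     (\<forall>U. open U \<longrightarrow> (\<forall>X\<in>vfields A U. (\<lambda>p. \<phi> p (X p)) \<in> vfields A U))"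

definition symmetric_form ::
    "('m::topological_space, 'd::finite) atlas \<Rightarrow> ('m \<Rightarrow> 'm tvec \<Rightarrow> 'm tvec \<Rightarrow> real) \<Rightarrow> bool" where
  "symmetric_form A g \<longleftrightarrow>
     (\<forall>p. \<forall>x\<in>tangent_space A p. \<forall>y\<in>tangent_space A p. \<forall>z\<in>tangent_space A p. \<forall>c.
        g p x y = g p y x \<and>
        g p (x + y) z = g p x z + g p y z \<and> g p (c *\<^sub>R x) z = c * g p x z) \<and>
     (\<forall>U. open U \<longrightarrow> (\<forall>X\<in>vfields A U. \<forall>Y\<in>vfields A U.
        (\<lambda>p. g p (X p) (Y p)) \<in> smooth_funs A U))"

text \<open>
  Signature \<open>(r, s)\<close>: every tangent space has an orthonormal basis with \<open>r\<close> vectors of square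
  \<open>1\<close> and \<open>s\<close> of square \<open>-1\<close> (orthonormality makes the vectors linearly independent).
\<close>

definition pseudo_riemannian ::
    "('m::topological_space, 'd::finite) atlas \<Rightarrow> nat \<Rightarrow> nat
      \<Rightarrow> ('m \<Rightarrow> 'm tvec \<Rightarrow> 'm tvec \<Rightarrow> real) \<Rightarrow> bool" where
  "pseudo_riemannian A r s g \<longleftrightarrow>
     symmetric_form A g \<and>
     (\<forall>p. \<exists>(e :: 'd \<Rightarrow> 'm tvec) P.
        span (range e) = tangent_space A p \<and> card P = r \<and> card (- P) = s \<and>
        (\<forall>i j. g p (e i) (e j) = (if i \<noteq> j then 0 else if i \<in> P then 1 else -1)))"


section \<open>Connections and curvature\<close>

text \<open>
  A connection is given on vector fields over arbitrary open sets. That \<open>D X Y\<close> at \<open>p\<close> only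
  depends on \<open>X\<close> and \<open>Y\<close> near \<open>p\<close> follows from the axioms, since \<open>f\<close> may be the indicator
  function of \<open>U\<close>.
\<close>

definition affine_connection ::
    "('m::topological_space, 'd::finite) atlas \<Rightarrow> ('m vfield \<Rightarrow> 'm vfield \<Rightarrow> 'm vfield)
      \<Rightarrow> bool" where
  "affine_connection A D \<longleftrightarrow>
     (\<forall>U. open U \<longrightarrow>
       (\<forall>X\<in>vfields A U. \<forall>Y\<in>vfields A U. \<forall>Z\<in>vfields A U. \<forall>f\<in>smooth_funs A U.
          D X Y \<in> vfields A U \<and>
          (\<forall>p\<in>U.
             D (\<lambda>q. X q + Z q) Y p = D X Y p + D Z Y p \<and>
             D (\<lambda>q. f q *\<^sub>R X q) Y p = f p *\<^sub>R D X Y p \<and>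
             D X (\<lambda>q. Y q + Z q) p = D X Y p + D X Z p \<and>
             D X (\<lambda>q. f q *\<^sub>R Y q) p = dir (X p) f *\<^sub>R Y p + f p *\<^sub>R D X Y p)))"

definition levi_civita ::
    "('m::topological_space, 'd::finite) atlas \<Rightarrow> ('m \<Rightarrow> 'm tvec \<Rightarrow> 'm tvec \<Rightarrow> real)
      \<Rightarrow> ('m vfield \<Rightarrow> 'm vfield \<Rightarrow> 'm vfield) \<Rightarrow> bool" where
  "levi_civita A g D \<longleftrightarrow>
     affine_connection A D \<and>
     (\<forall>U. open U \<longrightarrow>
       (\<forall>X\<in>vfields A U. \<forall>Y\<in>vfields A U. \<forall>Z\<in>vfields A U. \<forall>p\<in>U.
          D X Y p - D Y X p = lie_bracket A X Y p \<and>
          dir (Z p) (\<lambda>q. g q (X q) (Y q)) = g p (D Z X p) (Y p) + g p (X p) (D Z Y p)))"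

definition curv ::
    "('m::topological_space, 'd::finite) atlas \<Rightarrow> ('m vfield \<Rightarrow> 'm vfield \<Rightarrow> 'm vfield)
      \<Rightarrow> 'm vfield \<Rightarrow> 'm vfield \<Rightarrow> 'm vfield \<Rightarrow> 'm vfield" where
  "curv A D X Y Z p = D X (D Y Z) p - D Y (D X Z) p - D (lie_bracket A X Y) Z p"

definition local_frame ::
    "('m::topological_space, 'd::finite) atlas \<Rightarrow> 'm set \<Rightarrow> ('d \<Rightarrow> 'm vfield) \<Rightarrow> bool" where
  "local_frame A U e \<longleftrightarrow>
     open U \<and> (\<forall>i. e i \<in> vfields A U) \<and>
     (\<forall>p\<in>U. inj (\<lambda>i. e i p) \<and> independent (range (\<lambda>i. e i p)) \<and>
             span (range (\<lambda>i. e i p)) = tangent_space A p)"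

text \<open>
  Traces are taken in an arbitrarily chosen local frame around the point; they do not depend
  on this choice. \<open>metric_inverse g e p\<close> is the matrix \<open>g\<^sup>i\<^sup>j\<close>.
\<close>

definition frame_at ::
    "('m::topological_space, 'd::finite) atlas \<Rightarrow> 'm \<Rightarrow> 'd \<Rightarrow> 'm vfield" where
  "frame_at A p = (SOME e. \<exists>U. p \<in> U \<and> local_frame A U e)"

definition metric_inverse ::
    "('m \<Rightarrow> 'm tvec \<Rightarrow> 'm tvec \<Rightarrow> real) \<Rightarrow> ('d::finite \<Rightarrow> 'm vfield) \<Rightarrow> 'm \<Rightarrow> real^'d^'d" where
  "metric_inverse g e p = matrix_inv (\<chi> i j. g p (e i p) (e j p))"

definition ricci ::
    "('m::topological_space, 'd::finite) atlas \<Rightarrow> ('m \<Rightarrow> 'm tvec \<Rightarrow> 'm tvec \<Rightarrow> real)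
      \<Rightarrow> ('m vfield \<Rightarrow> 'm vfield \<Rightarrow> 'm vfield) \<Rightarrow> 'm vfield \<Rightarrow> 'm vfield \<Rightarrow> 'm \<Rightarrow> real" where
  "ricci A g D Y Z p = (let e = frame_at A p in
     \<Sum>i\<in>UNIV. \<Sum>j\<in>UNIV. metric_inverse g e p $ i $ j * g p (curv A D (e i) Y Z p) (e j p))"

definition scalar_curv ::
    "('m::topological_space, 'd::finite) atlas \<Rightarrow> ('m \<Rightarrow> 'm tvec \<Rightarrow> 'm tvec \<Rightarrow> real)
      \<Rightarrow> ('m vfield \<Rightarrow> 'm vfield \<Rightarrow> 'm vfield) \<Rightarrow> 'm \<Rightarrow> real" where
  "scalar_curv A g D p = (let e = frame_at A p in
     \<Sum>i\<in>UNIV. \<Sum>j\<in>UNIV. metric_inverse g e p $ i $ j * ricci A g D (e i) (e j) p)"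

definition lie_deriv ::
    "('m::topological_space, 'd::finite) atlas \<Rightarrow> 'm vfield
      \<Rightarrow> ('m \<Rightarrow> 'm tvec \<Rightarrow> 'm tvec \<Rightarrow> real) \<Rightarrow> 'm vfield \<Rightarrow> 'm vfield \<Rightarrow> 'm \<Rightarrow> real" where
  "lie_deriv A v g X Y p =
     dir (v p) (\<lambda>q. g q (X q) (Y q)) - g p (lie_bracket A v X p) (Y p)
       - g p (X p) (lie_bracket A v Y p)"


section \<open>Almost contact B-metric manifolds\<close>

definition almost_contact_B_metric ::
    "nat \<Rightarrow> ('m::{t2_space, second_countable_topology}, 'd::finite) atlas
      \<Rightarrow> ('m \<Rightarrow> 'm tvec \<Rightarrow> 'm tvec) \<Rightarrow> 'm vfield \<Rightarrow> ('m \<Rightarrow> 'm tvec \<Rightarrow> real)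
      \<Rightarrow> ('m \<Rightarrow> 'm tvec \<Rightarrow> 'm tvec \<Rightarrow> real) \<Rightarrow> bool" where
  "almost_contact_B_metric n A \<phi> \<xi> \<eta> g \<longleftrightarrow>
     CARD('d) = 2 * n + 1 \<and> smooth_atlas A \<and>
     endo_field A \<phi> \<and> \<xi> \<in> vfields A UNIV \<and> one_form A \<eta> \<and> pseudo_riemannian A (n + 1) n g \<and>
     (\<forall>p. \<phi> p (\<xi> p) = 0 \<and> \<eta> p (\<xi> p) = 1 \<and>
        (\<forall>x\<in>tangent_space A p. \<forall>y\<in>tangent_space A p.
           \<phi> p (\<phi> p x) = - x + \<eta> p x *\<^sub>R \<xi> p \<and>
           \<eta> p (\<phi> p x) = 0 \<and>
           g p (\<phi> p x) (\<phi> p y) = - g p x y + \<eta> p x * \<eta> p y))"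

definition associated_metric ::
    "('m \<Rightarrow> 'm tvec \<Rightarrow> 'm tvec) \<Rightarrow> ('m \<Rightarrow> 'm tvec \<Rightarrow> real)
      \<Rightarrow> ('m \<Rightarrow> 'm tvec \<Rightarrow> 'm tvec \<Rightarrow> real) \<Rightarrow> 'm \<Rightarrow> 'm tvec \<Rightarrow> 'm tvec \<Rightarrow> real" where
  "associated_metric \<phi> \<eta> g p x y = g p x (\<phi> p y) + \<eta> p x * \<eta> p y"

text \<open>In the following definitions, \<open>D\<close> stands for the Levi-Civita connection of \<open>g\<close>.\<close>

definition sasaki_like ::
    "('m::topological_space, 'd::finite) atlas
      \<Rightarrow> ('m \<Rightarrow> 'm tvec \<Rightarrow> 'm tvec) \<Rightarrow> 'm vfield \<Rightarrow> ('m \<Rightarrow> 'm tvec \<Rightarrow> real)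
      \<Rightarrow> ('m \<Rightarrow> 'm tvec \<Rightarrow> 'm tvec \<Rightarrow> real) \<Rightarrow> ('m vfield \<Rightarrow> 'm vfield \<Rightarrow> 'm vfield) \<Rightarrow> bool" where
  "sasaki_like A \<phi> \<xi> \<eta> g D \<longleftrightarrow>
     (\<forall>U. open U \<longrightarrow> (\<forall>X\<in>vfields A U. \<forall>Y\<in>vfields A U. \<forall>p\<in>U.
        D X (\<lambda>q. \<phi> q (Y q)) p - \<phi> p (D X Y p) =
          - (g p (X p) (Y p) *\<^sub>R \<xi> p) - \<eta> p (Y p) *\<^sub>R X p
            + (2 * \<eta> p (X p) * \<eta> p (Y p)) *\<^sub>R \<xi> p))"

definition einstein_like ::
    "('m::topological_space, 'd::finite) atlas
      \<Rightarrow> ('m \<Rightarrow> 'm tvec \<Rightarrow> 'm tvec) \<Rightarrow> ('m \<Rightarrow> 'm tvec \<Rightarrow> real)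
      \<Rightarrow> ('m \<Rightarrow> 'm tvec \<Rightarrow> 'm tvec \<Rightarrow> real) \<Rightarrow> ('m vfield \<Rightarrow> 'm vfield \<Rightarrow> 'm vfield) \<Rightarrow> bool" where
  "einstein_like A \<phi> \<eta> g D \<longleftrightarrow>
     (\<exists>a b c. \<forall>U. open U \<longrightarrow> (\<forall>X\<in>vfields A U. \<forall>Y\<in>vfields A U. \<forall>p\<in>U.
        ricci A g D X Y p =
          a * g p (X p) (Y p) + b * associated_metric \<phi> \<eta> g p (X p) (Y p)
            + c * \<eta> p (X p) * \<eta> p (Y p)))"

definition ricci_like_soliton ::
    "('m::topological_space, 'd::finite) atlas
      \<Rightarrow> ('m \<Rightarrow> 'm tvec \<Rightarrow> 'm tvec) \<Rightarrow> ('m \<Rightarrow> 'm tvec \<Rightarrow> real)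
      \<Rightarrow> ('m \<Rightarrow> 'm tvec \<Rightarrow> 'm tvec \<Rightarrow> real) \<Rightarrow> ('m vfield \<Rightarrow> 'm vfield \<Rightarrow> 'm vfield)
      \<Rightarrow> 'm vfield \<Rightarrow> bool" where
  "ricci_like_soliton A \<phi> \<eta> g D v \<longleftrightarrow>
     (\<exists>l m k :: real. \<forall>U. open U \<longrightarrow> (\<forall>X\<in>vfields A U. \<forall>Y\<in>vfields A U. \<forall>p\<in>U.
        1/2 * lie_deriv A v g X Y p + ricci A g D X Y p
          + l * g p (X p) (Y p) + m * associated_metric \<phi> \<eta> g p (X p) (Y p)
          + k * \<eta> p (X p) * \<eta> p (Y p) = 0))"

end

theory Submission
  imports Defs
begin

text \<open>
  The result rests on one observation: on every Sasaki-like manifold the Ricci tensor \<open>\<rho>\<close> is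
  invariant under the flow of the Reeb field, \<open>\<L>\<^sub>\<xi> \<rho> = 0\<close>, while the horizontal part of \<open>g\<close> is
  not: the flow of \<open>\<xi>\<close> rotates \<open>g - \<eta> \<otimes> \<eta>\<close> and \<open>g(\<cdot>, \<phi> \<cdot>)\<close> into each other. An
  Einstein-like Ricci tensor has the form \<open>a (g - \<eta> \<otimes> \<eta>) + b g(\<cdot>, \<phi> \<cdot>) + k \<eta> \<otimes> \<eta>\<close> with
  constants \<open>a\<close>, \<open>b\<close>, \<open>k\<close>; its Lie derivative along \<open>\<xi>\<close> is the rotated horizontal part, up to
  a factor, so invariance kills the horizontal part and leaves \<open>\<rho> = k \<eta> \<otimes> \<eta>\<close>. The value
  \<open>k = \<rho>(\<xi>, \<xi>) = 2n\<close> is a direct trace, because \<open>R(X, Y)\<xi> = \<eta>(Y) X - \<eta>(X) Y\<close>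
  (\<open>einstein_like_ricci\<close>).

  Invariance of \<open>\<rho>\<close> comes from comparing connections. If a torsion-free connection \<open>D\<close> changes
  by a symmetric tensor \<open>W\<close>, its curvature changes to first order by
  \<open>(D\<^sub>X W)(Y, Z) - (D\<^sub>Y W)(X, Z)\<close>. Here \<open>W = T \<xi>\<close>, where \<open>T\<close> is a combination of
  \<open>g - \<eta> \<otimes> \<eta>\<close> and \<open>g(\<cdot>, \<phi> \<cdot>)\<close> with constant coefficients. For all such \<open>T\<close> the trace over \<open>X\<close> of
  this expression vanishes (\<open>trace_curv_variation\<close>): two contributions cancel and the third
  is a multiple of the trace of \<open>\<phi>\<close>, which is zero since \<open>\<phi>\<^sup>3 = -\<phi>\<close>
  (\<open>trace_zero_if_cube_eq_minus\<close>).

  This is used twice. The Lie derivative of \<open>D\<close> along \<open>\<xi>\<close> is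
  \<open>2 (g - \<eta> \<otimes> \<eta>) \<xi>\<close> (\<open>lie_xi_connection\<close>), which gives \<open>\<L>\<^sub>\<xi> \<rho> = 0\<close>
  (\<open>ricci_xi_invariant\<close>). The Levi-Civita connection of the associated metric differs from \<open>D\<close> by
  \<open>-(g - \<eta> \<otimes> \<eta> + g(\<cdot>, \<phi> \<cdot>)) \<xi>\<close> (\<open>assoc_levi_civita\<close>); the change of its curvature
  is exactly the first-order term, the quadratic one vanishing because \<open>T(\<cdot>, \<xi>) = 0\<close>. Hence both
  metrics have the same Ricci tensor \<open>2n \<eta> \<otimes> \<eta>\<close> (\<open>assoc_ricci\<close>), and as \<open>\<xi>\<close> is a unit
  vector dual to \<open>\<eta>\<close> for both, tracing gives \<open>2n\<close> both times (\<open>scalar_curv_eta_square\<close>).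

  The curvature is traced as \<open>\<Sum>\<^sub>k dx\<^sup>k(R(\<partial>\<^sub>k, Y)Z)\<close> in a coordinate frame
  (\<open>ricci_trace\<close>). The dual frame \<open>dx\<^sup>k\<close> acts by differentiating the coordinate functions,
  so the components of smooth fields are smooth by definition, and no metric enters the formula.
\<close>

section \<open>Smooth functions of several real variables\<close>

lemma Ck_on_cong:
  assumes "open S" "\<And>x. x \<in> S \<Longrightarrow> f x = g x"
  shows "Ck_on k f S \<longleftrightarrow> Ck_on k g S"
  using assms(2)
proof (induction k arbitrary: f g)
  case 0
  then show ?case by (simp cong: continuous_on_cong)
next
  case (Suc k)
  have hd: "(f has_derivative F) (at x) \<longleftrightarrow> (g has_derivative F) (at x)" if "x \<in> S" for x F
    using has_derivative_transform_within_open[OF _ assms(1) that] Suc.prems by metis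
  have 1: "f differentiable (at x) \<longleftrightarrow> g differentiable (at x)" if "x \<in> S" for x
    using hd[OF that] by (simp add: differentiable_def)
  have 2: "frechet_derivative f (at x) = frechet_derivative g (at x)" if "x \<in> S" for x
    using hd[OF that] by (simp add: frechet_derivative_def)
  have "Ck_on k (\<lambda>x. frechet_derivative f (at x) v) S \<longleftrightarrow> Ck_on k (\<lambda>x. frechet_derivative g (at x) v)
    S" for v
    by (rule Suc.IH) (simp add: 2)
  with 1 show ?case by auto
qed

lemma Ck_on_subset: "Ck_on k f S \<Longrightarrow> T \<subseteq> S \<Longrightarrow> Ck_on k f T"
  by (induction k arbitrary: f) (auto intro: continuous_on_subset)

lemma Ck_on_SucD: "Ck_on (Suc k) f S \<Longrightarrow> Ck_on k f S"
proof (induction k arbitrary: f)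
  case 0
  then show ?case
    by (auto intro!: continuous_at_imp_continuous_on differentiable_imp_continuous_within)
next
  case (Suc k)
  show ?case using Suc.prems Suc.IH by (metis Ck_on.simps(2))
qed

lemma Ck_on_const: "Ck_on k (\<lambda>x. c) S"
  by (induction k arbitrary: c) auto

lemma Ck_on_bounded_linear: "bounded_linear h \<Longrightarrow> Ck_on k h S"
proof (induction k)
  case 0
  then show ?case by (simp add: linear_continuous_on)
next
  case (Suc k)
  have "frechet_derivative h (at x) = h" for x
    using Suc.prems bounded_linear_imp_has_derivative frechet_derivative_at by metis
  moreover have "h differentiable (at x)" for x
    using Suc.prems bounded_linear_imp_differentiable by blast
  ultimately show ?case by (simp add: Ck_on_const)
qed

lemma Ck_on_add:
  assumes "open S" "Ck_on k f S" "Ck_on k g S"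
  shows "Ck_on k (\<lambda>x. f x + g x) S"
  using assms(2,3)
proof (induction k arbitrary: f g)
  case 0
  then show ?case by (simp add: continuous_on_add)
next
  case (Suc k)
  have d: "frechet_derivative (\<lambda>x. f x + g x) (at x) = (\<lambda>v. frechet_derivative f (at x) v +
    frechet_derivative g (at x) v)"
    if "x \<in> S" for x
    using Suc.prems that
    by (intro frechet_derivative_at[symmetric] has_derivative_add)
      (simp_all add: frechet_derivative_works[symmetric])
  have "Ck_on k (\<lambda>x. frechet_derivative f (at x) v + frechet_derivative g (at x) v) S" for v
    using Suc by simp
  then have "Ck_on k (\<lambda>x. frechet_derivative (\<lambda>x. f x + g x) (at x) v) S" for v
    by (subst Ck_on_cong[OF assms(1)]) (auto simp: d)
  then show ?case using Suc.prems by (auto intro: differentiable_add)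
qed

lemma Ck_on_scaleR:
  fixes f :: "'a::euclidean_space \<Rightarrow> real"
  assumes "open S" "Ck_on k f S" "Ck_on k g S"
  shows "Ck_on k (\<lambda>x. f x *\<^sub>R g x) S"
  using assms(2,3)
proof (induction k arbitrary: f g)
  case 0
  then show ?case by (simp add: continuous_on_scaleR)
next
  case (Suc k)
  have d: "((\<lambda>x. f x *\<^sub>R g x) has_derivative
      (\<lambda>v. f x *\<^sub>R frechet_derivative g (at x) v + frechet_derivative f (at x) v *\<^sub>R g x)) (at x)"
    if "x \<in> S" for x
    using Suc.prems that
    by (intro has_derivative_scaleR) (simp_all add: frechet_derivative_works[symmetric])
  have "Ck_on k (\<lambda>x. f x *\<^sub>R frechet_derivative g (at x) v +
    frechet_derivative f (at x) v *\<^sub>R g x) S" for v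
    using Suc.prems Ck_on_SucD[OF Suc.prems(1)] Ck_on_SucD[OF Suc.prems(2)]
    by (intro Ck_on_add assms(1) Suc.IH) auto
  then have "Ck_on k (\<lambda>x. frechet_derivative (\<lambda>x. f x *\<^sub>R g x) (at x) v) S" for v
    by (subst Ck_on_cong[OF assms(1)]) (auto simp: frechet_derivative_at[OF d, symmetric])
  then show ?case using d by (auto simp: differentiable_def)
qed

lemma Ck_on_sum:
  assumes "open S" "\<And>i. i \<in> I \<Longrightarrow> Ck_on k (f i) S"
  shows "Ck_on k (\<lambda>x. \<Sum>i\<in>I. f i x) S"
  using assms(2)
  by (induction I rule: infinite_finite_induct) (auto simp: Ck_on_const intro!: Ck_on_add assms(1))

text \<open>
  The chain rule with the outer derivative expanded in the standard basis. In this form the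
  derivative of a composition is a sum of products of functions one order less smooth, as the
  induction for \<open>Ck_on_compose\<close> needs.
\<close>

lemma frechet_derivative_comp_Basis:
  fixes f :: "'b::euclidean_space \<Rightarrow> 'c::real_normed_vector" and g :: "'a::euclidean_space \<Rightarrow> 'b"
  assumes "g differentiable (at x)" "f differentiable (at (g x))"
  shows "((\<lambda>x. f (g x)) has_derivative (\<lambda>v. \<Sum>b\<in>Basis.
    (frechet_derivative g (at x) v \<bullet> b) *\<^sub>R frechet_derivative f (at (g x)) b)) (at x)"
proof -
  have f: "(f has_derivative frechet_derivative f (at (g x))) (at (g x))"
    and g: "(g has_derivative frechet_derivative g (at x)) (at x)"
    using assms by (auto simp: frechet_derivative_works[symmetric])
  interpret F: linear "frechet_derivative f (at (g x))"
    using f has_derivative_linear by blast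
  have "frechet_derivative f (at (g x)) u =
    (\<Sum>b\<in>Basis. (u \<bullet> b) *\<^sub>R frechet_derivative f (at (g x)) b)" for u
    by (subst (1) euclidean_representation[symmetric]) (simp only: F.sum F.scaleR)
  then have "(\<lambda>v. frechet_derivative f (at (g x)) (frechet_derivative g (at x) v)) = (\<lambda>v. \<Sum>b\<in>Basis.
    (frechet_derivative g (at x) v \<bullet> b) *\<^sub>R frechet_derivative f (at (g x)) b)"
    by blast
  with has_derivative_compose[OF g f] show ?thesis
    by simp
qed

lemma Ck_on_compose:
  fixes f :: "'b::euclidean_space \<Rightarrow> 'c::real_normed_vector" and g :: "'a::euclidean_space \<Rightarrow> 'b"
  assumes "open S" "open T" "g ` S \<subseteq> T" "Ck_on k g S" "Ck_on k f T"
  shows "Ck_on k (\<lambda>x. f (g x)) S"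
  using assms(4,5)
proof (induction k arbitrary: f)
  case 0
  then show ?case using continuous_on_compose2[OF _ _ assms(3)] by simp
next
  case (Suc k)
  have d: "((\<lambda>x. f (g x)) has_derivative (\<lambda>v. \<Sum>b\<in>Basis.
    (frechet_derivative g (at x) v \<bullet> b) *\<^sub>R frechet_derivative f (at (g x)) b)) (at x)"
    if "x \<in> S" for x
    using Suc.prems that assms(3) by (intro frechet_derivative_comp_Basis) auto
  have "Ck_on k (\<lambda>x. \<Sum>b\<in>Basis.
    (frechet_derivative g (at x) v \<bullet> b) *\<^sub>R frechet_derivative f (at (g x)) b) S" for v
  proof (intro Ck_on_sum Ck_on_scaleR assms(1))
    fix b :: 'b
    have "Ck_on k (\<lambda>x. frechet_derivative g (at x) v) S"
      using Suc.prems by simp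
    have gen: "Ck_on k (\<lambda>x. h x \<bullet> b) S" if "Ck_on k h S" for h :: "'a \<Rightarrow> 'b" and k
      using that
    proof (induction k arbitrary: h)
      case 0
      then show ?case by (auto intro: continuous_intros)
    next
      case (Suc k)
      have d: "((\<lambda>x. h x \<bullet> b) has_derivative (\<lambda>v. frechet_derivative h (at x) v \<bullet> b)) (at x)"
        if "x \<in> S" for x
        using Suc.prems that by (intro has_derivative_inner_left)
          (simp_all add: frechet_derivative_works[symmetric])
      have "Ck_on k (\<lambda>x. frechet_derivative h (at x) v \<bullet> b) S" for v
        using Suc by simp
      then have "Ck_on k (\<lambda>x. frechet_derivative (\<lambda>x. h x \<bullet> b) (at x) v) S" for v
        by (subst Ck_on_cong[OF assms(1)]) (auto simp: frechet_derivative_at[OF d, symmetric])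
      then show ?case using d by (auto simp: differentiable_def)
    qed
    show "Ck_on k (\<lambda>x. frechet_derivative g (at x) v \<bullet> b) S"
      by (rule gen) fact
    show "Ck_on k (\<lambda>x. frechet_derivative f (at (g x)) b) S"
      using Suc.prems Ck_on_SucD[OF Suc.prems(1)] by (intro Suc.IH) simp_all
  qed
  then have "Ck_on k (\<lambda>x. frechet_derivative (\<lambda>x. f (g x)) (at x) v) S" for v
    by (subst Ck_on_cong[OF assms(1)]) (auto simp: frechet_derivative_at[OF d, symmetric])
  then show ?case using d by (auto simp: differentiable_def)
qed

lemma smooth_on_cong: "open S \<Longrightarrow> (\<And>x. x \<in> S \<Longrightarrow> f x = g x) \<Longrightarrow> smooth_on f S \<longleftrightarrow> smooth_on g S"
  unfolding smooth_on_def using Ck_on_cong by blast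

lemma smooth_on_subset: "smooth_on f S \<Longrightarrow> T \<subseteq> S \<Longrightarrow> smooth_on f T"
  unfolding smooth_on_def using Ck_on_subset by blast

lemma smooth_on_differentiable: "smooth_on f S \<Longrightarrow> x \<in> S \<Longrightarrow> f differentiable (at x)"
  unfolding smooth_on_def by (metis Ck_on.simps(2))

lemma smooth_on_derivative: "smooth_on f S \<Longrightarrow> smooth_on (\<lambda>x. frechet_derivative f (at x) v) S"
  unfolding smooth_on_def by (metis Ck_on.simps(2))

lemma smooth_on_compose:
  fixes f :: "'b::euclidean_space \<Rightarrow> 'c::real_normed_vector" and g :: "'a::euclidean_space \<Rightarrow> 'b"
  assumes "open S" "open T" "g ` S \<subseteq> T" "smooth_on g S" "smooth_on f T"
  shows "smooth_on (\<lambda>x. f (g x)) S"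
  using assms Ck_on_compose unfolding smooth_on_def by blast

section \<open>Calculus on a manifold\<close>

lemma dir_simps [simp]:
  "dir 0 f = 0" "dir (v + w) f = dir v f + dir w f" "dir (- v) f = - dir v f"
  "dir (v - w) f = dir v f - dir w f" "dir (c *\<^sub>R v) f = c * dir v f"
  by (simp_all add: zero_tvec_def plus_tvec_def uminus_tvec_def minus_tvec_def scaleR_tvec_def
      Tvec_inverse)

lemma dir_sum: "dir (\<Sum>i\<in>I. v i) f = (\<Sum>i\<in>I. dir (v i) f)"
  by (induction I rule: infinite_finite_induct) auto

locale smooth_manifold =
  fixes A :: "('m::{t2_space, second_countable_topology}, 'd::finite) atlas"
  assumes smooth_atlas: "smooth_atlas A"
begin

lemma chart_exists: obtains V x where "(V, x) \<in> A" "p \<in> V"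
proof -
  have "p \<in> (\<Union>(V, x)\<in>A. V)"
    using smooth_atlas by (simp add: smooth_atlas_def)
  then show ?thesis using that by auto
qed

context
  fixes V x
  assumes Vx: "(V, x) \<in> A"
begin

lemma chart_homeo: "homeomorphism V (x ` V) x (inv_into V x)"
proof -
  obtain y where y: "homeomorphism V (x ` V) x y"
    using smooth_atlas Vx unfolding smooth_atlas_def by fast
  then have "inj_on x V"
    unfolding homeomorphism_def by (metis inj_on_inverseI)
  then have "inv_into V x u = y u" if "u \<in> x ` V" for u
    using y that unfolding homeomorphism_def by (metis imageE inv_into_f_f)
  then show ?thesis
    using y by (simp add: homeomorphism_def cong: continuous_on_cong)
qed

lemma chart_open: "open V" "open (x ` V)"
  using smooth_atlas Vx unfolding smooth_atlas_def by fast+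

lemma chart_inv [simp]: "q \<in> V \<Longrightarrow> inv_into V x (x q) = q"
  using chart_homeo by (simp add: homeomorphism_def)

lemma chart_open_image: "open U \<Longrightarrow> open (x ` (U \<inter> V))"
  using homeomorphism_imp_open_map[OF chart_homeo, of "U \<inter> V"] chart_open
  by (metis inf_commute open_Int openin_open_eq openin_open_Int)

end

lemma chart_change_smooth:
  assumes "(V, x) \<in> A" "(W, y) \<in> A"
  shows "smooth_on (\<lambda>u. y (inv_into V x u)) (x ` (V \<inter> W))"
  using smooth_atlas assms unfolding smooth_atlas_def by (fastforce simp: o_def)

lemma smooth_funs_chart:
  "f \<in> smooth_funs A U \<Longrightarrow> (V, x) \<in> A \<Longrightarrow> smooth_on (\<lambda>u. f (inv_into V x u)) (x ` (U \<inter> V))"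
  by (auto simp: smooth_funs_def o_def)

lemma smooth_funsI:
  assumes "\<And>V x. (V, x) \<in> A \<Longrightarrow> smooth_on (\<lambda>u. f (inv_into V x u)) (x ` (U \<inter> V))"
  shows "f \<in> smooth_funs A U"
  using assms by (auto simp: smooth_funs_def o_def)

lemma smooth_funs_cong:
  assumes "open U" "\<And>q. q \<in> U \<Longrightarrow> f q = h q"
  shows "f \<in> smooth_funs A U \<longleftrightarrow> h \<in> smooth_funs A U"
proof -
  have "smooth_on (\<lambda>u. f (inv_into V x u)) (x ` (U \<inter> V)) \<longleftrightarrow>
        smooth_on (\<lambda>u. h (inv_into V x u)) (x ` (U \<inter> V))" if "(V, x) \<in> A" for V x
    using assms chart_open_image[OF that assms(1)] that by (intro smooth_on_cong) auto
  then show ?thesis by (simp add: smooth_funs_def o_def split_beta)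
qed

lemma smooth_funs_subset: "f \<in> smooth_funs A U \<Longrightarrow> U' \<subseteq> U \<Longrightarrow> f \<in> smooth_funs A U'"
  by (rule smooth_funsI) (rule smooth_on_subset[OF smooth_funs_chart], auto)

lemma smooth_funs_const: "(\<lambda>q. c) \<in> smooth_funs A U"
  by (rule smooth_funsI) (simp add: smooth_on_def Ck_on_const)

lemma smooth_funs_add:
  assumes "open U" "f \<in> smooth_funs A U" "h \<in> smooth_funs A U"
  shows "(\<lambda>q. f q + h q) \<in> smooth_funs A U"
  by (rule smooth_funsI)
    (use assms smooth_funs_chart chart_open_image in \<open>fastforce simp: smooth_on_def intro!:
      Ck_on_add\<close>)

lemma smooth_funs_mult:
  assumes "open U" "f \<in> smooth_funs A U" "h \<in> smooth_funs A U"
  shows "(\<lambda>q. f q * h q) \<in> smooth_funs A U"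
  unfolding real_scaleR_def[symmetric]
  by (rule smooth_funsI)
    (use assms smooth_funs_chart chart_open_image in \<open>fastforce simp del: real_scaleR_def simp:
      smooth_on_def intro!: Ck_on_scaleR\<close>)

lemma smooth_funs_minus:
  assumes "open U" "f \<in> smooth_funs A U"
  shows "(\<lambda>q. - f q) \<in> smooth_funs A U"
  using smooth_funs_mult[OF assms(1) smooth_funs_const[of "-1"] assms(2)] by simp

lemma smooth_funs_diff:
  assumes "open U" "f \<in> smooth_funs A U" "h \<in> smooth_funs A U"
  shows "(\<lambda>q. f q - h q) \<in> smooth_funs A U"
  using smooth_funs_add[OF assms(1,2) smooth_funs_minus[OF assms(1,3)]] by simp

lemma smooth_funs_sum:
  assumes "open U" "\<And>i. i \<in> I \<Longrightarrow> f i \<in> smooth_funs A U"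
  shows "(\<lambda>q. \<Sum>i\<in>I. f i q) \<in> smooth_funs A U"
  using assms(2)
  by (induction I rule: infinite_finite_induct)
    (auto simp: smooth_funs_const intro!: smooth_funs_add assms(1))

text \<open>
  On a subset of a chart domain one chart suffices, since coordinate changes are smooth.
\<close>

lemma smooth_funsI_chart:
  assumes Vx: "(V, x) \<in> A" and U: "open U" "U \<subseteq> V"
    and f: "smooth_on (\<lambda>u. f (inv_into V x u)) (x ` U)"
  shows "f \<in> smooth_funs A U"
proof (rule smooth_funsI)
  fix W y assume Wy: "(W, y) \<in> A"
  have o: "open (y ` (U \<inter> W))" "open (x ` U)"
    using chart_open_image[OF Wy U(1)] chart_open_image[OF Vx U(1)] U(2) by
      (simp_all add: Int_absorb2)
  have "smooth_on (\<lambda>u. x (inv_into W y u)) (y ` (U \<inter> W))"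
    using U(2) by (intro smooth_on_subset[OF chart_change_smooth[OF Wy Vx]]) auto
  moreover have "(\<lambda>u. x (inv_into W y u)) ` y ` (U \<inter> W) \<subseteq> x ` U"
    using Wy by auto
  ultimately have "smooth_on (\<lambda>u. f (inv_into V x (x (inv_into W y u)))) (y ` (U \<inter> W))"
    using smooth_on_compose[where g = "\<lambda>u. x (inv_into W y u)" and f = "\<lambda>u. f
      (inv_into V x u)"] f o by blast
  then show "smooth_on (\<lambda>u. f (inv_into W y u)) (y ` (U \<inter> W))"
    using Vx Wy U by (subst smooth_on_cong[OF o(1)]) auto
qed

lemma coord_smooth:
  assumes Vx: "(V, x) \<in> A" and U: "open U" "U \<subseteq> V"
  shows "(\<lambda>q. x q $ i) \<in> smooth_funs A U"
proof (rule smooth_funsI_chart[OF assms])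
  have "open (x ` U)" using chart_open_image[OF Vx U(1)] U(2) by (simp add: Int_absorb2)
  moreover have "smooth_on (\<lambda>u. u $ i) (x ` U)"
    by (simp add: smooth_on_def Ck_on_bounded_linear bounded_linear_vec_nth)
  ultimately show "smooth_on (\<lambda>u. x (inv_into V x u) $ i) (x ` U)"
    using Vx U by (subst smooth_on_cong) auto
qed

lemma smooth_atI: "f \<in> smooth_funs A U \<Longrightarrow> open U \<Longrightarrow> p \<in> U \<Longrightarrow> smooth_at A p f"
  by (auto simp: smooth_at_def)

lemma smooth_at_cong:
  assumes "open U" "p \<in> U" "\<And>q. q \<in> U \<Longrightarrow> f q = h q"
  shows "smooth_at A p f \<longleftrightarrow> smooth_at A p h"
proof -
  have "smooth_at A p h" if "smooth_at A p f" "\<And>q. q \<in> U \<Longrightarrow> f q = h q" for f h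
  proof -
    obtain U' where "open U'" "p \<in> U'" "f \<in> smooth_funs A U'"
      using \<open>smooth_at A p f\<close> by (auto simp: smooth_at_def)
    then have "h \<in> smooth_funs A (U \<inter> U')"
      using that(2) assms(1) by (subst smooth_funs_cong[where h=f]) (auto intro: smooth_funs_subset)
    then show ?thesis using \<open>open U'\<close> \<open>p \<in> U'\<close> assms by (intro smooth_atI[of _ "U \<inter> U'"]) auto
  qed
  then show ?thesis using assms(3) by metis
qed

lemma smooth_at_differentiable:
  assumes "smooth_at A p f" "(V, x) \<in> A" "p \<in> V"
  shows "(\<lambda>u. f (inv_into V x u)) differentiable (at (x p))"
  using assms smooth_funs_chart smooth_on_differentiable unfolding smooth_at_def
  by (metis IntI imageI)

lemma dir_coord_vec:
  "dir (coord_vec A (V, x) p w) f =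
    (if smooth_at A p f then frechet_derivative (\<lambda>u. f (inv_into V x u)) (at (x p)) w else 0)"
  by (simp add: coord_vec_def Tvec_inverse o_def)

lemma tvec_eqI: "(\<And>f. dir s f = dir t f) \<Longrightarrow> s = t"
  by (metis dir_inject ext)

text \<open>
  Chain rule for coordinate vectors. It makes every chart at \<open>p\<close> parametrise the same tangent
  space, which is therefore a linear subspace.
\<close>

lemma coord_vec_change:
  assumes Vx: "(V, x) \<in> A" "p \<in> V" and Wy: "(W, y) \<in> A" "p \<in> W"
  shows "coord_vec A (V, x) p w =
    coord_vec A (W, y) p (frechet_derivative (\<lambda>u. y (inv_into V x u)) (at (x p)) w)"
proof (rule tvec_eqI, simp add: dir_coord_vec, intro impI)
  fix f assume f: "smooth_at A p f"
  let ?g = "\<lambda>u. y (inv_into V x u)" and ?f = "\<lambda>u. f (inv_into W y u)"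
  have g: "?g differentiable (at (x p))"
    using smooth_on_differentiable[OF chart_change_smooth[OF Vx(1) Wy(1)]] Vx Wy by blast
  have fd: "?f differentiable (at (?g (x p)))"
    using smooth_at_differentiable[OF f Wy] Vx by simp
  have fx: "(\<lambda>u. f (inv_into V x u)) differentiable (at (x p))"
    using smooth_at_differentiable[OF f Vx] .
  have "frechet_derivative (\<lambda>u. f (inv_into V x u)) (at (x p)) =
    frechet_derivative (?f \<circ> ?g) (at (x p))"
    using fx
  proof (rule frechet_derivative_transform_within_open)
    show "open (x ` (W \<inter> V))" using chart_open_image[OF Vx(1)] chart_open[OF Wy(1)] by simp
  qed (use Vx Wy in auto)
  also have "\<dots> = frechet_derivative ?f (at (?g (x p))) \<circ> frechet_derivative ?g (at (x p))"
    using g fd by (rule frechet_derivative_compose)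
  finally show "frechet_derivative (\<lambda>u. f (inv_into V x u)) (at (x p)) w =
    frechet_derivative ?f (at (y p)) (frechet_derivative ?g (at (x p)) w)"
    using Vx by simp
qed

lemma tangent_space_chart:
  assumes "(V, x) \<in> A" "p \<in> V"
  shows "tangent_space A p = range (coord_vec A (V, x) p)"
proof
  show "tangent_space A p \<subseteq> range (coord_vec A (V, x) p)"
    using coord_vec_change[OF _ _ assms] by (auto simp: tangent_space_def)
  show "range (coord_vec A (V, x) p) \<subseteq> tangent_space A p"
    using assms by (auto simp: tangent_space_def)
qed

lemma linear_coord_vec:
  assumes "(V, x) \<in> A" "p \<in> V"
  shows "linear (coord_vec A (V, x) p)"
proof (rule linearI; rule tvec_eqI)
  fix f
  have lin: "linear (frechet_derivative (\<lambda>u. f (inv_into V x u)) (at (x p)))" if "smooth_at A p f"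
    using smooth_at_differentiable[OF that assms] by (rule linear_frechet_derivative)
  show "dir (coord_vec A (V, x) p (b1 + b2)) f = dir (coord_vec A (V, x) p b1 + coord_vec A (V,
    x) p b2) f" for b1 b2
    using lin by (simp add: dir_coord_vec linear_add)
  show "dir (coord_vec A (V, x) p (r *\<^sub>R b)) f = dir (r *\<^sub>R coord_vec A (V, x) p b) f" for r b
    using lin by (simp add: dir_coord_vec linear_scale)
qed

lemma subspace_tangent_space: "subspace (tangent_space A p)"
proof -
  obtain V x where "(V, x) \<in> A" "p \<in> V" using chart_exists .
  then show ?thesis
    using linear_subspace_image[OF linear_coord_vec subspace_UNIV] by
      (simp add: tangent_space_chart)
qed

lemmas tangent_space_closed [simp, intro] =
  subspace_tangent_space[THEN subspace_0] subspace_tangent_space[THEN subspace_add]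
  subspace_tangent_space[THEN subspace_diff] subspace_tangent_space[THEN subspace_neg]
  subspace_tangent_space[THEN subspace_scale] subspace_tangent_space[THEN subspace_sum]

lemma tangent_vecE:
  assumes "t \<in> tangent_space A p"
  obtains V x w where "(V, x) \<in> A" "p \<in> V" "t = coord_vec A (V, x) p w"
  using assms by (auto simp: tangent_space_def)

text \<open>
  Tangent vectors see germs only. Together with \<open>dir_plus\<close> and \<open>dir_times\<close> this is what makes
  them derivations at \<open>p\<close>.
\<close>

lemma dir_cong:
  assumes "t \<in> tangent_space A p" "open U" "p \<in> U" "\<And>q. q \<in> U \<Longrightarrow> f q = h q"
  shows "dir t f = dir t h"
proof -
  obtain V x w where V: "(V, x) \<in> A" "p \<in> V" and t: "t = coord_vec A (V, x) p w"
    using assms(1) by (rule tangent_vecE)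
  have "frechet_derivative (\<lambda>u. f (inv_into V x u)) (at (x p)) = frechet_derivative (\<lambda>u. h
    (inv_into V x u)) (at (x p))"
    if "smooth_at A p f"
    using smooth_at_differentiable[OF that V]
  proof (rule frechet_derivative_transform_within_open)
    show "open (x ` (U \<inter> V))" using chart_open_image V assms by blast
  qed (use V assms in auto)
  moreover have "smooth_at A p f \<longleftrightarrow> smooth_at A p h" using assms(2-4) by (rule smooth_at_cong)
  ultimately show ?thesis by (simp add: t dir_coord_vec)
qed

lemma dir_const:
  assumes "t \<in> tangent_space A p"
  shows "dir t (\<lambda>q. c) = 0"
  using assms by (auto elim!: tangent_vecE simp: dir_coord_vec)

lemma dir_plus_times:
  assumes t: "t \<in> tangent_space A p" and U: "open U" "p \<in> U"
    and f: "f \<in> smooth_funs A U" and h: "h \<in> smooth_funs A U"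
  shows dir_plus: "dir t (\<lambda>q. f q + h q) = dir t f + dir t h"
    and dir_times: "dir t (\<lambda>q. f q * h q) = dir t f * h p + f p * dir t h"
proof -
  obtain V x w where V: "(V, x) \<in> A" "p \<in> V" and t: "t = coord_vec A (V, x) p w"
    using t by (rule tangent_vecE)
  let ?f = "\<lambda>u. f (inv_into V x u)" and ?h = "\<lambda>u. h (inv_into V x u)"
  have s: "smooth_at A p f" "smooth_at A p h" "smooth_at A p (\<lambda>q. f q + h q)"
    "smooth_at A p (\<lambda>q. f q * h q)"
    using U f h by (auto intro!: smooth_atI[of _ U] smooth_funs_add smooth_funs_mult)
  have d: "(?f has_derivative frechet_derivative ?f (at (x p))) (at (x p))"
    "(?h has_derivative frechet_derivative ?h (at (x p))) (at (x p))"
    using smooth_at_differentiable[OF _ V] s(1,2) by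
      (simp_all add: frechet_derivative_works[symmetric])
  show "dir t (\<lambda>q. f q + h q) = dir t f + dir t h"
    by (simp add: t dir_coord_vec s frechet_derivative_at[OF has_derivative_add[OF d], symmetric])
  show "dir t (\<lambda>q. f q * h q) = dir t f * h p + f p * dir t h"
    using V by (simp add: t dir_coord_vec s frechet_derivative_at[OF has_derivative_mult[OF d],
      symmetric])
qed

lemma dir_cmult:
  assumes t: "t \<in> tangent_space A p" and U: "open U" "p \<in> U" and f: "f \<in> smooth_funs A U"
  shows "dir t (\<lambda>q. c * f q) = c * dir t f"
  using dir_times[OF t U smooth_funs_const f] dir_const[OF t] by simp

lemma dir_diff:
  assumes t: "t \<in> tangent_space A p" and U: "open U" "p \<in> U"
    and f: "f \<in> smooth_funs A U" and h: "h \<in> smooth_funs A U"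
  shows "dir t (\<lambda>q. f q - h q) = dir t f - dir t h"
  using dir_plus[OF t U f smooth_funs_minus[OF U(1) h]] dir_cmult[OF t U h, of "-1"] by simp

lemma dir_fsum:
  assumes t: "t \<in> tangent_space A p" and U: "open U" "p \<in> U"
    and f: "\<And>i. i \<in> I \<Longrightarrow> f i \<in> smooth_funs A U"
  shows "dir t (\<lambda>q. \<Sum>i\<in>I. f i q) = (\<Sum>i\<in>I. dir t (f i))"
  using f
proof (induction I rule: infinite_finite_induct)
  case (insert i I)
  then have "dir t (\<lambda>q. f i q + (\<Sum>i\<in>I. f i q)) = dir t (f i) + dir t (\<lambda>q. \<Sum>i\<in>I. f i q)"
    using U by (intro dir_plus[OF t U] smooth_funs_sum) auto
  with insert show ?case by simp
qed (use dir_const[OF t] in auto)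

lemma vfieldsI:
  assumes "\<And>q. q \<in> U \<Longrightarrow> X q \<in> tangent_space A q"
    and "\<And>V f. open V \<Longrightarrow> V \<subseteq> U \<Longrightarrow> f \<in> smooth_funs A V \<Longrightarrow> (\<lambda>q. dir (X q) f) \<in> smooth_funs A V"
  shows "X \<in> vfields A U"
  using assms by (auto simp: vfields_def)

lemma vfields_tangent: "X \<in> vfields A U \<Longrightarrow> p \<in> U \<Longrightarrow> X p \<in> tangent_space A p"
  by (auto simp: vfields_def)

lemma vfields_dir:
  "X \<in> vfields A U \<Longrightarrow> open V \<Longrightarrow> V \<subseteq> U \<Longrightarrow> f \<in> smooth_funs A V \<Longrightarrow> (\<lambda>q. dir (X q) f) \<in> smooth_funs A V"
  by (auto simp: vfields_def)

lemma vfields_subset: "X \<in> vfields A U \<Longrightarrow> U' \<subseteq> U \<Longrightarrow> X \<in> vfields A U'"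
  by (auto simp: vfields_def)

declare vfields_tangent [simp]

lemma vfields_cong:
  assumes "\<And>q. q \<in> U \<Longrightarrow> X q = Y q" "X \<in> vfields A U"
  shows "Y \<in> vfields A U"
proof (rule vfieldsI)
  show "Y q \<in> tangent_space A q" if "q \<in> U" for q
    using assms that by (metis vfields_tangent)
  fix V f assume V: "open V" "V \<subseteq> U" "f \<in> smooth_funs A V"
  then have "(\<lambda>q. dir (X q) f) \<in> smooth_funs A V" using assms(2) vfields_dir by blast
  then show "(\<lambda>q. dir (Y q) f) \<in> smooth_funs A V"
    using V assms(1) by (subst smooth_funs_cong[where h = "\<lambda>q. dir (X q) f"]) auto
qed

lemma vfields_zero: "(\<lambda>q. 0) \<in> vfields A U"
  by (rule vfieldsI) (auto simp: smooth_funs_const)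

lemma vfields_add: "X \<in> vfields A U \<Longrightarrow> Y \<in> vfields A U \<Longrightarrow> (\<lambda>q. X q + Y q) \<in> vfields A U"
  by (rule vfieldsI) (simp, simp add: smooth_funs_add vfields_dir)

lemma vfields_scale: "f \<in> smooth_funs A U \<Longrightarrow> X \<in> vfields A U \<Longrightarrow> (\<lambda>q. f q *\<^sub>R X q) \<in> vfields A U"
  by (rule vfieldsI) (simp, simp add: smooth_funs_mult vfields_dir smooth_funs_subset[of f U])

lemma vfields_minus: "X \<in> vfields A U \<Longrightarrow> (\<lambda>q. - X q) \<in> vfields A U"
  using vfields_scale[OF smooth_funs_const[of "-1"], of X U] by simp

lemma vfields_diff: "X \<in> vfields A U \<Longrightarrow> Y \<in> vfields A U \<Longrightarrow> (\<lambda>q. X q - Y q) \<in> vfields A U"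
  using vfields_add[OF _ vfields_minus] by auto

lemma vfields_sum: "(\<And>i. i \<in> I \<Longrightarrow> X i \<in> vfields A U) \<Longrightarrow> (\<lambda>q. \<Sum>i\<in>I. X i q) \<in> vfields A U"
  by (induction I rule: infinite_finite_induct) (auto intro: vfields_zero vfields_add)

lemma dir_lie_bracket:
  "smooth_at A p f \<Longrightarrow> dir (lie_bracket A X Y p) f =
    dir (X p) (\<lambda>q. dir (Y q) f) - dir (Y p) (\<lambda>q. dir (X q) f)"
  by (simp add: lie_bracket_def Tvec_inverse)

definition coord_frame :: "'m set \<Rightarrow> ('m \<Rightarrow> real^'d) \<Rightarrow> 'd \<Rightarrow> 'm vfield" where
  "coord_frame V x i q = coord_vec A (V, x) q (axis i 1)"

abbreviation coord :: "('m \<Rightarrow> real^'d) \<Rightarrow> 'd \<Rightarrow> 'm \<Rightarrow> real" where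
  "coord x i \<equiv> \<lambda>q. x q $ i"

context
  fixes V x
  assumes Vx: "(V, x) \<in> A"
begin

lemma dir_coord:
  assumes "p \<in> V"
  shows "dir (coord_vec A (V, x) p w) (coord x i) = w $ i"
proof -
  have o: "open (x ` V)" using chart_open Vx by blast
  have s: "smooth_at A p (coord x i)"
    using coord_smooth[OF Vx] chart_open[OF Vx] assms by (auto intro: smooth_atI)
  have "frechet_derivative (\<lambda>u. x (inv_into V x u) $ i) (at (x p)) =
    frechet_derivative (\<lambda>u. u $ i) (at (x p))"
    using smooth_at_differentiable[OF s Vx assms]
    by (rule frechet_derivative_transform_within_open[OF _ o]) (use Vx assms in auto)
  also have "\<dots> = (\<lambda>u. u $ i)"
    by (rule frechet_derivative_at[symmetric]) (rule bounded_linear_imp_has_derivative,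
      rule bounded_linear_vec_nth)
  finally show ?thesis using s by (simp add: dir_coord_vec)
qed

lemma dir_coord_frame_coord: "p \<in> V \<Longrightarrow> dir (coord_frame V x i p) (coord x j) = (if i =
  j then 1 else 0)"
  by (simp add: coord_frame_def dir_coord axis_def)

lemma coord_frame_tangent [simp]: "p \<in> V \<Longrightarrow> coord_frame V x i p \<in> tangent_space A p"
  using Vx by (auto simp: coord_frame_def tangent_space_def)

text \<open>
  The components of \<open>t\<close> are its derivatives of the coordinate functions. For a smooth field
  they are smooth by the definition of a smooth field.
\<close>

lemma coord_frame_expand:
  assumes "p \<in> V" "t \<in> tangent_space A p"
  shows "t = (\<Sum>i\<in>UNIV. dir t (coord x i) *\<^sub>R coord_frame V x i p)"
proof -
  obtain w where t: "t = coord_vec A (V, x) p w"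
    using assms tangent_space_chart[OF Vx] by auto
  note lin = linear_coord_vec[OF Vx assms(1)]
  have "w = (\<Sum>i\<in>UNIV. w $ i *\<^sub>R axis i 1)"
    by (simp add: vec_eq_iff axis_def if_distrib cong: if_cong)
  then have "coord_vec A (V, x) p w = (\<Sum>i\<in>UNIV. w $ i *\<^sub>R coord_vec A (V, x) p (axis i 1))"
    using linear_sum[OF lin, of "\<lambda>i. w $ i *\<^sub>R axis i 1" UNIV] by (simp add: linear_scale[OF lin])
  moreover have "dir t (coord x i) = w $ i" for i
    using assms(1) by (simp add: t dir_coord)
  ultimately show ?thesis by (simp add: t coord_frame_def)
qed

lemma coord_frame_vfield:
  assumes "U \<subseteq> V"
  shows "coord_frame V x i \<in> vfields A U"
proof (rule vfieldsI)
  show "coord_frame V x i q \<in> tangent_space A q" if "q \<in> U" for q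
    using that assms by auto
  fix W f assume W: "open W" "W \<subseteq> U" "f \<in> smooth_funs A W"
  let ?F = "\<lambda>u. f (inv_into V x u)"
  have WV: "W \<inter> V = W" "W \<subseteq> V" using W assms by auto
  have o: "open (x ` W)" using chart_open_image[OF Vx W(1)] WV by simp
  have sm: "smooth_on (\<lambda>u. frechet_derivative ?F (at u) (axis i 1)) (x ` W)"
    using smooth_on_derivative[OF smooth_funs_chart[OF W(3) Vx]] WV by simp
  have eq: "frechet_derivative ?F (at u) (axis i 1) = dir (coord_frame V x i (inv_into V x u)) f"
    if "u \<in> x ` W" for u
    using that smooth_atI[OF W(3,1)] chart_inv[OF Vx] WV(2)
    by (auto simp: coord_frame_def dir_coord_vec subset_iff)
  have "smooth_on (\<lambda>u. dir (coord_frame V x i (inv_into V x u)) f) (x ` W)"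
    by (rule smooth_on_cong[OF o, THEN iffD1, OF eq sm])
  then show "(\<lambda>q. dir (coord_frame V x i q) f) \<in> smooth_funs A W"
    by (rule smooth_funsI_chart[OF Vx W(1) WV(2)])
qed

lemma coord_frame_local_frame: "local_frame A V (coord_frame V x)"
  unfolding local_frame_def
proof (intro conjI allI ballI)
  show "open V" using chart_open Vx by blast
  show "coord_frame V x i \<in> vfields A V" for i by (rule coord_frame_vfield) simp
  fix p assume p: "p \<in> V"
  have ax: "inj (\<lambda>i. axis i (1::real) :: real^'d)" "range (\<lambda>i. axis i (1::real) :: real^'d) = Basis"
    by (auto simp: inj_on_def axis_eq_axis Basis_vec_def)
  have inj: "inj (coord_vec A (V, x) p)"
    by (rule injI) (metis dir_coord[OF p] vec_eq_iff)
  show "inj (\<lambda>i. coord_frame V x i p)"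
    unfolding coord_frame_def using inj ax(1) by (auto simp: inj_on_def)
  have img: "range (\<lambda>i. coord_frame V x i p) = coord_vec A (V, x) p ` Basis"
    unfolding coord_frame_def ax(2)[symmetric] by auto
  show "independent (range (\<lambda>i. coord_frame V x i p))"
    unfolding img using linear_coord_vec[OF Vx p] independent_Basis
    by (rule linear_independent_injective_image) (rule inj_on_subset[OF inj], simp)
  show "span (range (\<lambda>i. coord_frame V x i p)) = tangent_space A p"
    unfolding img using linear_coord_vec[OF Vx p]
    by (simp add: linear_span_image tangent_space_chart[OF Vx p])
qed

end

lemma frame_at: obtains U where "p \<in> U" "local_frame A U (frame_at A p)"
proof -
  obtain V x where "(V, x) \<in> A" "p \<in> V" using chart_exists .
  then have ex: "\<exists>e U. p \<in> U \<and> local_frame A U e" using coord_frame_local_frame by blast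
  have "\<exists>U. p \<in> U \<and> local_frame A U (frame_at A p)"
    unfolding frame_at_def by (rule someI_ex[OF ex])
  then show ?thesis using that by blast
qed

end

section \<open>Metrics and torsion-free connections\<close>

locale symmetric_form_field = smooth_manifold A for A :: "('m::{t2_space,
  second_countable_topology}, 'd::finite) atlas" +
  fixes h :: "'m \<Rightarrow> 'm tvec \<Rightarrow> 'm tvec \<Rightarrow> real"
  assumes form: "symmetric_form A h"
begin

lemma form_sym: "x \<in> tangent_space A p \<Longrightarrow> y \<in> tangent_space A p \<Longrightarrow> h p x y = h p y x"
  using form unfolding symmetric_form_def by blast

lemma form_add_left [simp]: "x \<in> tangent_space A p \<Longrightarrow> y \<in> tangent_space A p \<Longrightarrow> z \<in> tangent_space A p \<Longrightarrow>
    h p (x + y) z = h p x z + h p y z"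
  using form unfolding symmetric_form_def by blast

lemma form_scale_left [simp]: "x \<in> tangent_space A p \<Longrightarrow> z \<in> tangent_space A p \<Longrightarrow>
    h p (c *\<^sub>R x) z = c * h p x z"
  using form unfolding symmetric_form_def by blast

lemma form_minus_left [simp]: "x \<in> tangent_space A p \<Longrightarrow> z \<in> tangent_space A p \<Longrightarrow>
    h p (- x) z = - h p x z"
  using form_scale_left[of x p z "-1"] by simp

lemma form_zero_left [simp]: "z \<in> tangent_space A p \<Longrightarrow> h p 0 z = 0"
  using form_scale_left[of 0 p z 0] by simp

lemma form_diff_left [simp]: "x \<in> tangent_space A p \<Longrightarrow> y \<in> tangent_space A p \<Longrightarrow>
  z \<in> tangent_space A p \<Longrightarrow>
    h p (x - y) z = h p x z - h p y z"
  using form_add_left[of x p "- y" z] by simp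

lemma form_right [simp]:
  assumes "z \<in> tangent_space A p"
  shows "x \<in> tangent_space A p \<Longrightarrow> y \<in> tangent_space A p \<Longrightarrow> h p z (x + y) = h p z x + h p z y"
    and "x \<in> tangent_space A p \<Longrightarrow> h p z (c *\<^sub>R x) = c * h p z x"
    and "x \<in> tangent_space A p \<Longrightarrow> h p z (- x) = - h p z x"
    and "x \<in> tangent_space A p \<Longrightarrow> y \<in> tangent_space A p \<Longrightarrow> h p z (x - y) = h p z x - h p z y"
    and "h p z 0 = 0"
  using assms by (simp_all add: form_sym[of z])

lemma form_sum_left:
  assumes "\<And>i. i \<in> I \<Longrightarrow> x i \<in> tangent_space A p" "z \<in> tangent_space A p"
  shows "h p (\<Sum>i\<in>I. x i) z = (\<Sum>i\<in>I. h p (x i) z)"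
  using assms(1) by (induction I rule: infinite_finite_induct) (auto simp: assms(2))

lemma form_smooth: "open U \<Longrightarrow> X \<in> vfields A U \<Longrightarrow> Y \<in> vfields A U \<Longrightarrow>
  (\<lambda>p. h p (X p) (Y p)) \<in> smooth_funs A U"
  using form by (simp add: symmetric_form_def)

end

locale metric_field = symmetric_form_field A h
  for A :: "('m::{t2_space, second_countable_topology}, 'd::finite) atlas" and h +
  assumes nondeg: "t \<in> tangent_space A p \<Longrightarrow> (\<And>s. s \<in> tangent_space A p \<Longrightarrow> h p t s = 0) \<Longrightarrow> t = 0"
begin

text \<open>
  The covectors \<open>t \<mapsto> \<Sum>\<^sub>j h\<^sup>i\<^sup>j h(t, e\<^sub>j)\<close> form the frame dual to \<open>e\<close>, whatever the metric. The Gram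
  matrix is invertible because a vector in its kernel would give a tangent vector orthogonal
  to the whole frame.
\<close>

lemma frame_dual:
  assumes e: "local_frame A U e" and p: "p \<in> U" and t: "t \<in> tangent_space A p"
  shows "t = (\<Sum>i\<in>UNIV. (\<Sum>j\<in>UNIV. metric_inverse h e p $ i $ j * h p t (e j p)) *\<^sub>R e i p)"
proof -
  define b where "b i = e i p" for i
  have b: "b i \<in> tangent_space A p" for i
    using e p vfields_tangent[of "e i" U p] by (simp add: b_def local_frame_def)
  have inj: "inj b" and ind: "independent (range b)" and sp: "span (range b) = tangent_space A p"
    using e p by (auto simp: b_def[abs_def] local_frame_def)
  define G :: "real^'d^'d" where "G = (\<chi> i j. h p (b i) (b j))"
  have coef: "\<exists>c. s = (\<Sum>i\<in>UNIV. c i *\<^sub>R b i)" if "s \<in> tangent_space A p" for s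
  proof -
    have "s \<in> range (\<lambda>u. \<Sum>v\<in>range b. u v *\<^sub>R v)"
      using that by (simp add: span_finite flip: sp)
    then obtain u where "s = (\<Sum>v\<in>range b. u v *\<^sub>R v)" by blast
    then show ?thesis by (intro exI[of _ "\<lambda>i. u (b i)"]) (simp add: sum.reindex[OF inj])
  qed
  have zero: "c i = 0" if "(\<Sum>i\<in>UNIV. c i *\<^sub>R b i) = 0" for c i
  proof -
    have "(\<Sum>v\<in>range b. c (inv b v) *\<^sub>R v) = 0"
      using that by (simp add: sum.reindex[OF inj] inj)
    then show ?thesis
      using independentD[OF ind, of "range b" "\<lambda>v. c (inv b v)" "b i"] inj by simp
  qed
  have hsum: "h p (\<Sum>i\<in>UNIV. c i *\<^sub>R b i) s = (\<Sum>i\<in>UNIV. c i * h p (b i) s)"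
    if "s \<in> tangent_space A p" for c s
    using that b by (simp add: form_sum_left)
  \<comment> \<open>a kernel vector yields a tangent vector orthogonal to the frame, hence to everything\<close>
  have "c = 0" if "G *v c = 0" for c
  proof -
    define s where "s = (\<Sum>i\<in>UNIV. c $ i *\<^sub>R b i)"
    have s: "s \<in> tangent_space A p" using b by (auto simp: s_def)
    have "h p s (b j) = (G *v c) $ j" for j
      using b by (simp add: s_def hsum G_def matrix_vector_mult_def form_sym[of "b j"] mult.commute)
    then have sb: "h p (b j) s = 0" for j using that s b by (simp add: form_sym[of s])
    have "h p s r = 0" if "r \<in> tangent_space A p" for r
    proof -
      from coef[OF that] obtain c where "r = (\<Sum>i\<in>UNIV. c i *\<^sub>R b i)" by blast
      then have "h p r s = 0" using s by (simp add: hsum sb)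
      then show ?thesis using that s by (simp add: form_sym)
    qed
    then have "s = 0" using nondeg s by blast
    then show ?thesis using zero[of "\<lambda>i. c $ i"] by (simp add: s_def vec_eq_iff)
  qed
  then have "invertible G"
    by (simp add: invertible_left_inverse matrix_left_invertible_ker)
  then have "matrix_inv G ** G = mat 1"
    unfolding invertible_def matrix_inv_def by (rule someI2_ex) simp
  then have id: "(\<Sum>j\<in>UNIV. matrix_inv G $ i $ j * G $ j $ k) = (if i = k then 1 else 0)" for i k
    by (simp add: vec_eq_iff matrix_matrix_mult_def mat_def)
  have Gsym: "h p (b k) (b j) = G $ j $ k" for j k
    using b by (simp add: G_def form_sym[of "b k"])
  obtain c where c: "t = (\<Sum>i\<in>UNIV. c i *\<^sub>R b i)" using coef[OF t] by blast
  have "(\<Sum>j\<in>UNIV. matrix_inv G $ i $ j * h p t (b j)) = c i" for i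
  proof -
    have "(\<Sum>j\<in>UNIV. matrix_inv G $ i $ j * h p t (b j)) =
      (\<Sum>j\<in>UNIV. \<Sum>k\<in>UNIV. c k * (matrix_inv G $ i $ j * G $ j $ k))"
      unfolding c using b by (simp add: hsum Gsym sum_distrib_left mult.left_commute)
    also have "\<dots> = (\<Sum>k\<in>UNIV. c k * (\<Sum>j\<in>UNIV. matrix_inv G $ i $ j * G $ j $ k))"
      by (subst sum.swap) (simp add: sum_distrib_left)
    also have "\<dots> = c i" by (simp add: id if_distrib cong: if_cong)
    finally show ?thesis .
  qed
  moreover have "metric_inverse h e p = matrix_inv G"
    by (simp add: metric_inverse_def G_def b_def)
  ultimately show ?thesis by (simp add: c b_def)
qed

end

text \<open>
  If \<open>\<eta>\<close> is dual to a unit vector \<open>\<xi>\<close>, then \<open>\<eta> \<otimes> \<eta>\<close> has trace \<open>\<eta>(\<xi>) = 1\<close>: the numbers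
  \<open>\<Sum>\<^sub>j h\<^sup>i\<^sup>j \<eta>(e\<^sub>j)\<close> are the components of \<open>\<xi>\<close>.
\<close>

lemma (in metric_field) scalar_curv_eta_square:
  assumes xi: "\<xi> \<in> tangent_space A p" and eta: "\<And>t. t \<in> tangent_space A p \<Longrightarrow> h p \<xi> t = \<eta> t"
    and unit: "\<eta> \<xi> = 1"
    and ric: "\<And>U Y Z. open U \<Longrightarrow> p \<in> U \<Longrightarrow> Y \<in> vfields A U \<Longrightarrow> Z \<in> vfields A U \<Longrightarrow>
      ricci A h D Y Z p = c * \<eta> (Y p) * \<eta> (Z p)"
  shows "scalar_curv A h D p = c"
proof -
  obtain W where W: "p \<in> W" "local_frame A W (frame_at A p)" by (rule frame_at)
  define e where "e = frame_at A p"
  have e: "open W" "e i \<in> vfields A W" for i using W by (auto simp: e_def local_frame_def)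
  have T: "e i p \<in> tangent_space A p" for i using vfields_tangent[OF e(2) W(1)] .
  define th where "th i = (\<Sum>j\<in>UNIV. metric_inverse h e p $ i $ j * h p \<xi> (e j p))" for i
  have "scalar_curv A h D p = (\<Sum>i\<in>UNIV. \<Sum>j\<in>UNIV. metric_inverse h e p $ i $ j * (c * \<eta> (e i p) * \<eta>
    (e j p)))"
    by (simp add: scalar_curv_def Let_def ric[OF e(1) W(1) e(2) e(2)] flip: e_def)
  also have "\<dots> = c * (\<Sum>i\<in>UNIV. th i * \<eta> (e i p))"
    by (simp add: th_def eta[OF T] sum_distrib_left sum_distrib_right mult_ac)
  also have "(\<Sum>i\<in>UNIV. th i * \<eta> (e i p)) = h p (\<Sum>i\<in>UNIV. th i *\<^sub>R e i p) \<xi>"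
    using T xi by (simp add: form_sum_left form_sym[of _ p \<xi>] eta)
  also have "(\<Sum>i\<in>UNIV. th i *\<^sub>R e i p) = \<xi>"
    unfolding th_def using frame_dual[OF W(2,1) xi] by (simp add: e_def)
  finally show ?thesis using eta[OF xi] unit by simp
qed

lemma (in smooth_manifold) pseudo_riemannian_metric_field:
  assumes "pseudo_riemannian A r s g"
  shows "metric_field A g"
proof -
  interpret symmetric_form_field A g
    using assms by unfold_locales (simp add: pseudo_riemannian_def)
  show ?thesis
  proof
    fix t p assume t: "t \<in> tangent_space A p" and z: "\<And>s. s \<in> tangent_space A p \<Longrightarrow> g p t s = 0"
    obtain e :: "'d \<Rightarrow> 'm tvec" and P where sp: "span (range e) = tangent_space A p"
      and on: "\<And>i j. g p (e i) (e j) = (if i \<noteq> j then 0 else if i \<in> P then 1 else -1)"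
      using assms unfolding pseudo_riemannian_def by metis
    have e: "e i \<in> tangent_space A p" for i using span_base[of "e i" "range e"] sp by simp
    have inj: "inj e"
      by (rule injI) (metis on one_neq_zero neg_equal_0_iff_equal)
    have "t \<in> range (\<lambda>u. \<Sum>v\<in>range e. u v *\<^sub>R v)"
      using t by (simp add: span_finite flip: sp)
    then obtain u where "t = (\<Sum>v\<in>range e. u v *\<^sub>R v)" by blast
    then have tu: "t = (\<Sum>i\<in>UNIV. u (e i) *\<^sub>R e i)" by (simp add: sum.reindex[OF inj])
    have "u (e j) = 0" for j
    proof -
      have "0 = (\<Sum>i\<in>UNIV. u (e i) * g p (e i) (e j))"
        using z[OF e[of j]] e by (simp add: tu form_sum_left)
      also have "\<dots> = (\<Sum>i\<in>UNIV. if i = j then u (e j) * g p (e j) (e j) else 0)"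
        by (intro sum.cong) (auto simp: on)
      finally show ?thesis using on[of j j] by (simp split: if_splits)
    qed
    then show "t = 0" by (simp add: tu)
  qed
qed

locale torsion_free_connection = smooth_manifold A for A :: "('m::{t2_space,
  second_countable_topology}, 'd::finite) atlas" +
  fixes D :: "'m vfield \<Rightarrow> 'm vfield \<Rightarrow> 'm vfield"
  assumes connection: "affine_connection A D"
    and torsion: "open U \<Longrightarrow> X \<in> vfields A U \<Longrightarrow> Y \<in> vfields A U \<Longrightarrow> p \<in> U \<Longrightarrow>
      lie_bracket A X Y p = D X Y p - D Y X p"
begin

context
  fixes U :: "'m set"
  assumes U [simp]: "open U"
begin

lemma D_vfield [simp]: "X \<in> vfields A U \<Longrightarrow> Y \<in> vfields A U \<Longrightarrow> D X Y \<in> vfields A U"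
  using connection smooth_funs_const unfolding affine_connection_def by (meson U)

lemma D_rules:
  assumes "X \<in> vfields A U" "Y \<in> vfields A U" "p \<in> U"
  shows D_add_left: "Z \<in> vfields A U \<Longrightarrow> D (\<lambda>q. X q + Z q) Y p = D X Y p + D Z Y p"
    and D_scale_left: "f \<in> smooth_funs A U \<Longrightarrow> D (\<lambda>q. f q *\<^sub>R X q) Y p = f p *\<^sub>R D X Y p"
    and D_add_right: "Z \<in> vfields A U \<Longrightarrow> D X (\<lambda>q. Y q + Z q) p = D X Y p + D X Z p"
    and D_scale_right: "f \<in> smooth_funs A U \<Longrightarrow>
      D X (\<lambda>q. f q *\<^sub>R Y q) p = dir (X p) f *\<^sub>R Y p + f p *\<^sub>R D X Y p"
proof -
  have *: "D (\<lambda>q. X q + Z q) Y p = D X Y p + D Z Y p \<and>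
      D (\<lambda>q. f q *\<^sub>R X q) Y p = f p *\<^sub>R D X Y p \<and>
      D X (\<lambda>q. Y q + Z q) p = D X Y p + D X Z p \<and>
      D X (\<lambda>q. f q *\<^sub>R Y q) p = dir (X p) f *\<^sub>R Y p + f p *\<^sub>R D X Y p"
    if "Z \<in> vfields A U" "f \<in> smooth_funs A U" for Z f
    using connection that assms U unfolding affine_connection_def by blast
  note c = smooth_funs_const[of 0 U]
  show "Z \<in> vfields A U \<Longrightarrow> D (\<lambda>q. X q + Z q) Y p = D X Y p + D Z Y p"
    "Z \<in> vfields A U \<Longrightarrow> D X (\<lambda>q. Y q + Z q) p = D X Y p + D X Z p"
    using *[OF _ c] by blast+
  show "f \<in> smooth_funs A U \<Longrightarrow> D (\<lambda>q. f q *\<^sub>R X q) Y p = f p *\<^sub>R D X Y p"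
    "f \<in> smooth_funs A U \<Longrightarrow>
      D X (\<lambda>q. f q *\<^sub>R Y q) p = dir (X p) f *\<^sub>R Y p + f p *\<^sub>R D X Y p"
    using *[OF assms(1)] by blast+
qed

text \<open>
  Multiplying by the indicator function of \<open>U\<close>, which is smooth on \<open>U\<close>, makes fields that agree on
  \<open>U\<close> equal as total functions. This is why connections are local; the same trick works in the
  second argument, where the derivative of the indicator function vanishes.
\<close>

lemma D_cong_left:
  assumes "X \<in> vfields A U" "X' \<in> vfields A U" "Y \<in> vfields A U" "p \<in> U"
    and "\<And>q. q \<in> U \<Longrightarrow> X q = X' q"
  shows "D X Y p = D X' Y p"
proof -
  let ?f = "indicator U :: 'm \<Rightarrow> real"
  have f: "?f \<in> smooth_funs A U"
    by (subst smooth_funs_cong[where h="\<lambda>q. 1"]) (auto simp: smooth_funs_const)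
  have "(\<lambda>q. ?f q *\<^sub>R X q) = (\<lambda>q. ?f q *\<^sub>R X' q)"
    using assms(5) by (auto simp: indicator_def fun_eq_iff)
  then show ?thesis
    using D_scale_left[OF assms(1,3,4) f] D_scale_left[OF assms(2,3,4) f] assms(4) by simp
qed

lemma D_cong_right:
  assumes "X \<in> vfields A U" "Y \<in> vfields A U" "Y' \<in> vfields A U" "p \<in> U"
    and "\<And>q. q \<in> U \<Longrightarrow> Y q = Y' q"
  shows "D X Y p = D X Y' p"
proof -
  let ?f = "indicator U :: 'm \<Rightarrow> real"
  have f: "?f \<in> smooth_funs A U"
    by (subst smooth_funs_cong[where h="\<lambda>q. 1"]) (auto simp: smooth_funs_const)
  have d: "dir (X p) ?f = 0"
    using dir_cong[of "X p" p U ?f "\<lambda>q. 1"] dir_const[of "X p" p 1] assms by simp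
  have "(\<lambda>q. ?f q *\<^sub>R Y q) = (\<lambda>q. ?f q *\<^sub>R Y' q)"
    using assms(5) by (auto simp: indicator_def fun_eq_iff)
  then show ?thesis
    using D_scale_right[OF assms(1,2,4) f] D_scale_right[OF assms(1,3,4) f] d assms(4) by simp
qed

lemma D_minus_right:
  assumes "X \<in> vfields A U" "Y \<in> vfields A U" "p \<in> U"
  shows "D X (\<lambda>q. - Y q) p = - D X Y p"
  using D_scale_right[OF assms smooth_funs_const[of "-1"]] dir_const[of "X p" p] assms by simp

lemma D_diff_right:
  assumes "X \<in> vfields A U" "Y \<in> vfields A U" "p \<in> U" "Z \<in> vfields A U"
  shows "D X (\<lambda>q. Y q - Z q) p = D X Y p - D X Z p"
  using D_add_right[OF assms(1-3) vfields_minus[OF assms(4)]] D_minus_right[OF assms(1,4,3)] by simp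

lemma D_minus_left:
  assumes "X \<in> vfields A U" "Y \<in> vfields A U" "p \<in> U"
  shows "D (\<lambda>q. - X q) Y p = - D X Y p"
  using D_scale_left[OF assms smooth_funs_const[of "-1"]] by simp

lemma D_diff_left:
  assumes "X \<in> vfields A U" "Y \<in> vfields A U" "p \<in> U" "Z \<in> vfields A U"
  shows "D (\<lambda>q. X q - Z q) Y p = D X Y p - D Z Y p"
  using D_add_left[OF assms(1-3) vfields_minus[OF assms(4)]] D_minus_left[OF assms(4,2,3)] by simp

lemma D_zero_right: "X \<in> vfields A U \<Longrightarrow> p \<in> U \<Longrightarrow> D X (\<lambda>q. 0) p = 0"
  using D_minus_right[OF _ vfields_zero, of X p] D_add_right[OF _ vfields_zero _ vfields_zero,
    of X p] by simp

lemma bracket_vfield [simp]: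
  assumes "X \<in> vfields A U" "Y \<in> vfields A U"
  shows "lie_bracket A X Y \<in> vfields A U"
proof (rule vfields_cong)
  show "(\<lambda>q. D X Y q - D Y X q) \<in> vfields A U" using assms by (intro vfields_diff) auto
  show "D X Y q - D Y X q = lie_bracket A X Y q" if "q \<in> U" for q
    using torsion[OF U assms that] by simp
qed

lemma bracket_scale_left:
  assumes "X \<in> vfields A U" "Y \<in> vfields A U" "f \<in> smooth_funs A U" "q \<in> U"
  shows "lie_bracket A (\<lambda>q. f q *\<^sub>R X q) Y q = f q *\<^sub>R lie_bracket A X Y q - dir (Y q) f *\<^sub>R X q"
  using assms by (simp add: torsion[OF U] vfields_scale D_scale_left D_scale_right algebra_simps)

lemma bracket_add_left:
  assumes "X \<in> vfields A U" "Y \<in> vfields A U" "Z \<in> vfields A U" "q \<in> U"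
  shows "lie_bracket A (\<lambda>q. X q + Z q) Y q = lie_bracket A X Y q + lie_bracket A Z Y q"
  using assms by (simp add: torsion[OF U] vfields_add D_add_left D_add_right algebra_simps)

lemma bracket_diff_right:
  assumes "X \<in> vfields A U" "Y \<in> vfields A U" "Z \<in> vfields A U" "q \<in> U"
  shows "lie_bracket A Y (\<lambda>q. X q - Z q) q = lie_bracket A Y X q - lie_bracket A Y Z q"
  using assms by (simp add: torsion[OF U] vfields_diff D_diff_left D_diff_right algebra_simps)

lemma bracket_cong_right:
  assumes "X \<in> vfields A U" "Y \<in> vfields A U" "Y' \<in> vfields A U" "p \<in> U"
    and "\<And>q. q \<in> U \<Longrightarrow> Y q = Y' q"
  shows "lie_bracket A X Y p = lie_bracket A X Y' p"
  using assms D_cong_left[OF assms(2,3,1,4,5)] D_cong_right[OF assms] by (simp add: torsion[OF U])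

lemma curv_vfield [simp]:
  assumes "X \<in> vfields A U" "Y \<in> vfields A U" "Z \<in> vfields A U"
  shows "curv A D X Y Z \<in> vfields A U"
  unfolding curv_def[abs_def] using assms by (intro vfields_diff) auto

lemma curv_add:
  assumes "X \<in> vfields A U" "Y \<in> vfields A U" "Z \<in> vfields A U" "X' \<in> vfields A U" "p \<in> U"
  shows "curv A D (\<lambda>q. X q + X' q) Y Z p = curv A D X Y Z p + curv A D X' Y Z p"
proof -
  have "D Y (D (\<lambda>q. X q + X' q) Z) p = D Y (\<lambda>q. D X Z q + D X' Z q) p"
    using assms by (intro D_cong_right) (simp_all add: vfields_add D_add_left)
  moreover have "D (lie_bracket A (\<lambda>q. X q + X' q) Y) Z p = D (\<lambda>q. lie_bracket A X Y q +
    lie_bracket A X' Y q) Z p"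
    using assms by (intro D_cong_left) (simp_all add: vfields_add bracket_add_left)
  ultimately show ?thesis
    using assms by (simp add: curv_def D_add_left D_add_right)
qed

text \<open>
  Linearity over functions: the derivatives of \<open>f\<close> produced by \<open>D\<^sub>Y (f D\<^sub>X Z)\<close> cancel against those
  produced by \<open>[f X, Y] = f [X, Y] - Y(f) X\<close>.
\<close>

lemma curv_scale:
  assumes "X \<in> vfields A U" "Y \<in> vfields A U" "Z \<in> vfields A U" "f \<in> smooth_funs A U" "p \<in> U"
  shows "curv A D (\<lambda>q. f q *\<^sub>R X q) Y Z p = f p *\<^sub>R curv A D X Y Z p"
proof -
  have df: "(\<lambda>q. dir (Y q) f) \<in> smooth_funs A U"
    using assms by (simp add: vfields_dir)
  have "D Y (D (\<lambda>q. f q *\<^sub>R X q) Z) p = D Y (\<lambda>q. f q *\<^sub>R D X Z q) p"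
    using assms by (intro D_cong_right) (simp_all add: vfields_scale D_scale_left)
  moreover have "D (lie_bracket A (\<lambda>q. f q *\<^sub>R X q) Y) Z p =
      D (\<lambda>q. f q *\<^sub>R lie_bracket A X Y q - dir (Y q) f *\<^sub>R X q) Z p"
    using assms df by (intro D_cong_left)
      (simp_all add: vfields_scale vfields_diff bracket_scale_left)
  ultimately show ?thesis
    using assms df by (simp add: curv_def D_scale_left D_scale_right D_diff_left vfields_scale
      algebra_simps)
qed

lemma curv_cong:
  assumes "X \<in> vfields A U" "X' \<in> vfields A U" "Y \<in> vfields A U" "Z \<in> vfields A U" "p \<in> U"
    and eq: "\<And>q. q \<in> U \<Longrightarrow> X q = X' q"
  shows "curv A D X Y Z p = curv A D X' Y Z p"
proof -
  have "D Y (D X Z) p = D Y (D X' Z) p"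
    using assms by (intro D_cong_right D_cong_left)
      (simp_all add: D_cong_left[OF assms(1,2,4) _ eq])
  moreover have "D (lie_bracket A X Y) Z p = D (lie_bracket A X' Y) Z p"
    using assms by (intro D_cong_left)
     (simp_all add: torsion[OF U] D_cong_left[OF assms(1-3) _ eq] D_cong_right[OF assms(3,1,2) _
       eq])
  moreover have "D X (D Y Z) p = D X' (D Y Z) p"
    using assms by (intro D_cong_left) simp_all
  ultimately show ?thesis by (simp add: curv_def)
qed

lemma curv_sum:
  assumes "finite I" "\<And>i. i \<in> I \<Longrightarrow> X i \<in> vfields A U" "\<And>i. i \<in> I \<Longrightarrow> f i \<in> smooth_funs A U"
    and "Y \<in> vfields A U" "Z \<in> vfields A U" "p \<in> U"
  shows "curv A D (\<lambda>q. \<Sum>i\<in>I. f i q *\<^sub>R X i q) Y Z p = (\<Sum>i\<in>I. f i p *\<^sub>R curv A D (X i) Y Z p)"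
  using assms(1-3)
proof (induction I rule: finite_induct)
  case empty
  have "curv A D (\<lambda>q. 0 *\<^sub>R Y q) Y Z p = 0 *\<^sub>R curv A D Y Y Z p"
    using assms by (intro curv_scale) (simp_all add: smooth_funs_const)
  then show ?case by simp
next
  case (insert i I)
  have "curv A D (\<lambda>q. f i q *\<^sub>R X i q + (\<Sum>i\<in>I. f i q *\<^sub>R X i q)) Y Z p =
      curv A D (\<lambda>q. f i q *\<^sub>R X i q) Y Z p + curv A D (\<lambda>q. \<Sum>i\<in>I. f i q *\<^sub>R X i q) Y Z p"
    using assms insert by (intro curv_add vfields_sum vfields_scale) auto
  also have "curv A D (\<lambda>q. f i q *\<^sub>R X i q) Y Z p = f i p *\<^sub>R curv A D (X i) Y Z p"
    using assms insert by (intro curv_scale) auto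
  finally show ?case using insert by simp
qed

lemma curv_expand:
  assumes "X \<in> vfields A U" "Y \<in> vfields A U" "Z \<in> vfields A U" "p \<in> U"
    and Vx: "(V, x) \<in> A" and "U \<subseteq> V"
  shows "curv A D X Y Z p = (\<Sum>i\<in>UNIV. dir (X p) (coord x i) *\<^sub>R curv A D (coord_frame V x i) Y Z p)"
proof -
  have sm: "(\<lambda>q. dir (X q) (coord x i)) \<in> smooth_funs A U" for i
    using vfields_dir[OF assms(1) U _ coord_smooth[OF Vx U]] assms(6) by simp
  have "curv A D X Y Z p = curv A D (\<lambda>q. \<Sum>i\<in>UNIV. dir (X q) (coord x i) *\<^sub>R coord_frame V x i q) Y
    Z p"
    using assms sm by (intro curv_cong vfields_sum vfields_scale coord_frame_vfield
      coord_frame_expand[OF Vx]) auto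
  also have "\<dots> = (\<Sum>i\<in>UNIV. dir (X p) (coord x i) *\<^sub>R curv A D (coord_frame V x i) Y Z p)"
    using assms sm by (intro curv_sum coord_frame_vfield) auto
  finally show ?thesis .
qed

lemma curv_skew: "X \<in> vfields A U \<Longrightarrow> Y \<in> vfields A U \<Longrightarrow> Z \<in> vfields A U \<Longrightarrow> p \<in> U \<Longrightarrow>
    curv A D X Y Z p = - curv A D Y X Z p"
proof -
  assume *: "X \<in> vfields A U" "Y \<in> vfields A U" "Z \<in> vfields A U" "p \<in> U"
  have "D (lie_bracket A X Y) Z p = D (\<lambda>q. - lie_bracket A Y X q) Z p"
    using * by (intro D_cong_left) (simp_all add: vfields_minus torsion[OF U])
  then show ?thesis using * by (simp add: curv_def D_minus_left)
qed

text \<open>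
  Both sides are third-order expressions in the same iterated derivatives of a function that is
  smooth near \<open>p\<close>, and tangent vectors are determined by their action on such functions.
\<close>

lemma jacobi:
  assumes "X \<in> vfields A U" "Y \<in> vfields A U" "Z \<in> vfields A U" "p \<in> U"
  shows "lie_bracket A X (lie_bracket A Y Z) p =
    lie_bracket A (lie_bracket A X Y) Z p + lie_bracket A Y (lie_bracket A X Z) p"
proof (rule tvec_eqI)
  fix f
  show "dir (lie_bracket A X (lie_bracket A Y Z) p) f =
    dir (lie_bracket A (lie_bracket A X Y) Z p + lie_bracket A Y (lie_bracket A X Z) p) f"
  proof (cases "smooth_at A p f")
    case False
    then show ?thesis by (simp add: lie_bracket_def Tvec_inverse)
  next
    case True
    then obtain W where W: "open W" "p \<in> W" "f \<in> smooth_funs A W" by (auto simp: smooth_at_def)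
    define N where "N = U \<inter> W"
    have N: "open N" "p \<in> N" "N \<subseteq> U" using W assms by (auto simp: N_def)
    have f: "f \<in> smooth_funs A N" using W smooth_funs_subset by (auto simp: N_def)
    have d: "(\<lambda>q. dir (X q) k) \<in> smooth_funs A N" if "X \<in> vfields A U" "k \<in> smooth_funs A N" for X k
      using vfields_dir[OF that(1) N(1,3) that(2)] .
    have br: "dir (lie_bracket A X Y q) k =
      dir (X q) (\<lambda>q. dir (Y q) k) - dir (Y q) (\<lambda>q. dir (X q) k)"
      if "q \<in> N" "k \<in> smooth_funs A N" for X Y q k
      using that N by (intro dir_lie_bracket smooth_atI)
    have *: "dir (X p) (\<lambda>q. dir (lie_bracket A Y Z q) f) =
        dir (X p) (\<lambda>q. dir (Y q) (\<lambda>r. dir (Z r) f)) - dir (X p) (\<lambda>q. dir (Z q) (\<lambda>r. dir (Y r) f))"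
      if "X \<in> vfields A U" "Y \<in> vfields A U" "Z \<in> vfields A U" for X Y Z
    proof -
      have "dir (X p) (\<lambda>q. dir (lie_bracket A Y Z q) f) =
          dir (X p) (\<lambda>q. dir (Y q) (\<lambda>r. dir (Z r) f) - dir (Z q) (\<lambda>r. dir (Y r) f))"
        using that assms N f by (intro dir_cong[OF _ N(1,2)] br) auto
      also have "\<dots> = dir (X p) (\<lambda>q. dir (Y q) (\<lambda>r. dir (Z r) f)) - dir (X p) (\<lambda>q. dir (Z q) (\<lambda>r.
        dir (Y r) f))"
        using that assms f by (intro dir_diff[OF _ N(1,2)] d) auto
      finally show ?thesis .
    qed
    show ?thesis
      using assms N f by (simp add: br d *)
  qed
qed

lemma bracket_anti: "X \<in> vfields A U \<Longrightarrow> Y \<in> vfields A U \<Longrightarrow> p \<in> U \<Longrightarrow>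
    lie_bracket A X Y p = - lie_bracket A Y X p"
  by (simp add: torsion[OF U])

lemma bracket_minus_right: "X \<in> vfields A U \<Longrightarrow> Y \<in> vfields A U \<Longrightarrow> p \<in> U \<Longrightarrow>
    lie_bracket A X (\<lambda>q. - Y q) p = - lie_bracket A X Y p"
  by (simp add: torsion[OF U] vfields_minus D_minus_left D_minus_right)

text \<open>
  The first Bianchi identity; for vanishing torsion the cyclic sum of the curvature reduces to
  the Jacobi identity.
\<close>

lemma bianchi:
  assumes "X \<in> vfields A U" "Y \<in> vfields A U" "Z \<in> vfields A U" "p \<in> U"
  shows "curv A D X Y Z p + curv A D Y Z X p + curv A D Z X Y p = 0"
proof -
  have *: "D X (D Y Z) p - D X (D Z Y) p = D X (lie_bracket A Y Z) p"
    if "X \<in> vfields A U" "Y \<in> vfields A U" "Z \<in> vfields A U" for X Y Z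
  proof -
    have "D X (lie_bracket A Y Z) p = D X (\<lambda>q. D Y Z q - D Z Y q) p"
      using that assms by (intro D_cong_right) (simp_all add: torsion[OF U] vfields_diff)
    then show ?thesis using that assms by (simp add: D_diff_right)
  qed
  have "curv A D X Y Z p + curv A D Y Z X p + curv A D Z X Y p =
      lie_bracket A X (lie_bracket A Y Z) p + lie_bracket A Y (lie_bracket A Z X) p +
        lie_bracket A Z (lie_bracket A X Y) p"
    using assms by (simp add: curv_def torsion[OF U, of _ "lie_bracket A _ _"] flip: *)
  also have "\<dots> = 0"
  proof -
    have "lie_bracket A Y (lie_bracket A Z X) p = lie_bracket A Y (\<lambda>q. - lie_bracket A X Z q) p"
      using assms by (intro bracket_cong_right bracket_anti) (simp_all add: vfields_minus)
    then show ?thesis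
      using jacobi[OF assms] bracket_anti[of Z "lie_bracket A X Y" p] assms
      by (simp add: bracket_minus_right)
  qed
  finally show ?thesis .
qed

end

text \<open>
  The trace of \<open>X \<mapsto> R(X, Y)Z\<close> can be taken in coordinates instead of the arbitrarily chosen frame
  around each point. Only after this replacement can the Ricci tensor be differentiated, because
  the chosen frame may vary irregularly from point to point.
\<close>

lemma ricci_trace:
  assumes "metric_field A h" and U: "open U" "p \<in> U" and YZ: "Y \<in> vfields A U" "Z \<in> vfields A U"
    and Vx: "(V, x) \<in> A" "p \<in> V"
  shows "ricci A h D Y Z p = (\<Sum>k\<in>UNIV. dir (curv A D (coord_frame V x k) Y Z p) (coord x k))"
proof -
  interpret metric_field A h by fact
  obtain W where W: "p \<in> W" "local_frame A W (frame_at A p)" by (rule frame_at)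
  define e where "e = frame_at A p"
  define N where "N = U \<inter> V \<inter> W"
  have e: "local_frame A W e" using W by (simp add: e_def)
  then have oW: "open W" and eW: "e i \<in> vfields A W" for i by (auto simp: local_frame_def)
  have N: "open N" "p \<in> N" "N \<subseteq> U" "N \<subseteq> V" "N \<subseteq> W"
    using U Vx W oW chart_open[OF Vx(1)] by (auto simp: N_def)
  have vf: "e i \<in> vfields A N" "Y \<in> vfields A N" "Z \<in> vfields A N"
    "coord_frame V x k \<in> vfields A N" for i k
    using eW YZ N vfields_subset coord_frame_vfield[OF Vx(1)] by blast+
  define c where "c k = curv A D (coord_frame V x k) Y Z p" for k
  define th where "th i t = (\<Sum>j\<in>UNIV. metric_inverse h e p $ i $ j * h p t (e j p))" for i t
  have c: "c k \<in> tangent_space A p" for k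
    using vfields_tangent[OF curv_vfield[OF N(1) vf(4,2,3)] N(2)] by (simp add: c_def)
  have ep: "e i p \<in> tangent_space A p" for i using vfields_tangent[OF vf(1) N(2)] .
  have exp: "curv A D (e i) Y Z p = (\<Sum>k\<in>UNIV. dir (e i p) (coord x k) *\<^sub>R c k)" for i
    unfolding c_def using curv_expand[OF N(1) vf(1-3) N(2) Vx(1) N(4)] .
  have thsum: "th i (\<Sum>k\<in>UNIV. a k *\<^sub>R c k) = (\<Sum>k\<in>UNIV. a k * th i (c k))" for i a
  proof -
    have "th i (\<Sum>k\<in>UNIV. a k *\<^sub>R c k) =
        (\<Sum>j\<in>UNIV. \<Sum>k\<in>UNIV. a k * (metric_inverse h e p $ i $ j * h p (c k) (e j p)))"
      using c ep by (simp add: th_def form_sum_left sum_distrib_left mult_ac)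
    also have "\<dots> = (\<Sum>k\<in>UNIV. a k * th i (c k))"
      by (subst sum.swap) (simp add: th_def sum_distrib_left)
    finally show ?thesis .
  qed
  have "ricci A h D Y Z p = (\<Sum>i\<in>UNIV. th i (curv A D (e i) Y Z p))"
    by (simp add: ricci_def Let_def e_def th_def)
  also have "\<dots> = (\<Sum>i\<in>UNIV. \<Sum>k\<in>UNIV. dir (e i p) (coord x k) * th i (c k))"
    by (simp add: exp thsum)
  also have "\<dots> = (\<Sum>k\<in>UNIV. dir (\<Sum>i\<in>UNIV. th i (c k) *\<^sub>R e i p) (coord x k))"
    by (subst sum.swap) (simp add: dir_sum mult_ac)
  also have "\<dots> = (\<Sum>k\<in>UNIV. dir (c k) (coord x k))"
    using frame_dual[OF e W(1) c] by (simp flip: th_def)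
  finally show ?thesis by (simp add: c_def)
qed

end

text \<open>
  Two tensors that violate these symmetries by the same amount differ by such a \<open>B\<close> and hence agree.
  This is the algebra behind the uniqueness of the Levi-Civita connection; it also determines
  \<open>R(\<xi>, X)Y\<close> in \<open>curv_xi_left\<close>.
\<close>

lemma symmetric_skew_zero:
  fixes B :: "'x \<Rightarrow> 'x \<Rightarrow> 'x \<Rightarrow> real"
  assumes "\<And>x y z. x \<in> S \<Longrightarrow> y \<in> S \<Longrightarrow> z \<in> S \<Longrightarrow> B x y z = B y x z"
    and "\<And>x y z. x \<in> S \<Longrightarrow> y \<in> S \<Longrightarrow> z \<in> S \<Longrightarrow> B x y z = - B x z y"
    and "x \<in> S" "y \<in> S" "z \<in> S"
  shows "B x y z = 0"
proof -
  have "B x y z = B y x z" "B y x z = - B y z x" "B y z x = B z y x" "B z y x = - B z x y"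
    "B z x y = B x z y" "B x z y = - B x y z"
    using assms by blast+
  then show ?thesis by simp
qed

context smooth_manifold
begin

lemma vfield_through:
  assumes "(V, x) \<in> A" "N \<subseteq> V" "p \<in> N" "t \<in> tangent_space A p"
  obtains X where "X \<in> vfields A N" "X p = t"
proof
  show "(\<lambda>q. \<Sum>i\<in>UNIV. dir t (coord x i) *\<^sub>R coord_frame V x i q) \<in> vfields A N"
    using assms by (intro vfields_sum vfields_scale[OF smooth_funs_const] coord_frame_vfield) auto
  show "(\<Sum>i\<in>UNIV. dir t (coord x i) *\<^sub>R coord_frame V x i p) = t"
    using coord_frame_expand[of V x p t] assms by (simp add: subset_iff)
qed

end

locale levi_civita_connection = metric_field A h + torsion_free_connection A D
  for A :: "('m::{t2_space, second_countable_topology}, 'd::finite) atlas" and h D +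
  assumes compat: "open U \<Longrightarrow> X \<in> vfields A U \<Longrightarrow> Y \<in> vfields A U \<Longrightarrow> Z \<in> vfields A U \<Longrightarrow> p \<in> U \<Longrightarrow>
      dir (Z p) (\<lambda>q. h q (X q) (Y q)) = h p (D Z X p) (Y p) + h p (X p) (D Z Y p)"
begin

text \<open>
  \<open>R(X, Y)\<close> annihilates the function \<open>h(Z, W)\<close>, since \<open>[X, Y]\<close> acts on functions as the commutator;
  the mixed terms of the second derivatives cancel.
\<close>

lemma curv_skew_metric:
  assumes U: "open U" and vf: "X \<in> vfields A U" "Y \<in> vfields A U" "Z \<in> vfields A U"
    "W \<in> vfields A U"
    and p: "p \<in> U"
  shows "h p (curv A D X Y Z p) (W p) = - h p (curv A D X Y W p) (Z p)"
proof -
  let ?F = "\<lambda>q. h q (Z q) (W q)"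
  have sm: "?F \<in> smooth_funs A U" using form_smooth[OF U] vf by simp
  have second: "dir (X p) (\<lambda>q. dir (Y q) ?F) =
      h p (D X (D Y Z) p) (W p) + h p (D Y Z p) (D X W p) + h p (D X Z p) (D Y W p) +
        h p (Z p) (D X (D Y W) p)"
    if "X \<in> vfields A U" "Y \<in> vfields A U" for X Y
  proof -
    have "dir (X p) (\<lambda>q. dir (Y q) ?F) = dir (X p) (\<lambda>q. h q (D Y Z q) (W q) + h q (Z q) (D Y W q))"
      using that vf p U compat by (intro dir_cong[of _ p U]) auto
    also have "\<dots> = dir (X p) (\<lambda>q. h q (D Y Z q) (W q)) + dir (X p) (\<lambda>q. h q (Z q) (D Y W q))"
      using that vf p U by (intro dir_plus[of _ p U] form_smooth) auto
    finally show ?thesis using that vf p U by (simp add: compat[of U])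
  qed
  have "dir (lie_bracket A X Y p) ?F = dir (X p) (\<lambda>q. dir (Y q) ?F) - dir (Y p) (\<lambda>q. dir (X q) ?F)"
    using sm U p by (intro dir_lie_bracket smooth_atI)
  moreover have "dir (lie_bracket A X Y p) ?F =
      h p (D (lie_bracket A X Y) Z p) (W p) + h p (Z p) (D (lie_bracket A X Y) W p)"
    using U vf p by (intro compat[of U]) auto
  moreover have T: "D X' Y' p \<in> tangent_space A p" if "X' \<in> vfields A U" "Y' \<in> vfields A U"
    for X' Y'
    using that vfields_tangent[OF D_vfield[OF U that] p] by simp
  ultimately have "h p (curv A D X Y Z p) (W p) + h p (Z p) (curv A D X Y W p) = 0"
    using vf U p by (simp add: curv_def second T vfields_tangent[OF _ p] del: vfields_tangent)
  then show ?thesis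
    using vf U p form_sym[of "Z p" p "curv A D X Y W p"]
    by (simp add: vfields_tangent[OF curv_vfield[OF U] p] vfields_tangent[OF _ p] del:
      vfields_tangent)
qed

end

lemma (in metric_field) levi_civita_connectionI:
  assumes "levi_civita A h D"
  shows "levi_civita_connection A h D"
proof
  show "affine_connection A D" using assms by (simp add: levi_civita_def)
next
  fix U X Y p assume "open U" "X \<in> vfields A U" "Y \<in> vfields A U" "p \<in> U"
  then show "lie_bracket A X Y p = D X Y p - D Y X p"
    using assms[unfolded levi_civita_def, THEN conjunct2, rule_format, of U X Y X p] by simp
next
  fix U X Y Z p assume "open U" "X \<in> vfields A U" "Y \<in> vfields A U" "Z \<in> vfields A U" "p \<in> U"
  then show "dir (Z p) (\<lambda>q. h q (X q) (Y q)) = h p (D Z X p) (Y p) + h p (X p) (D Z Y p)"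
    using assms[unfolded levi_civita_def, THEN conjunct2, rule_format, of U X Y Z p] by simp
qed

section \<open>The trace of a structure tensor vanishes\<close>

text \<open>
  In the Leibniz expansion a permutation other than the identity moves two indices, so its product
  still has a vanishing factor after one factor has been differentiated.
\<close>

lemma det_id_plus_derivative:
  fixes P :: "real \<Rightarrow> real^'d^'d"
  assumes d: "\<And>i j. ((\<lambda>t. P t $ i $ j) has_real_derivative P' $ i $ j) (at t0)" and P0: "P t0 =
    mat 1"
  shows "((\<lambda>t. det (P t)) has_real_derivative trace P') (at t0)"
proof -
  let ?G = "\<lambda>p. of_int (sign p) * (\<Sum>i\<in>UNIV. P' $ i $ p i * (\<Prod>j\<in>UNIV - {i}. P t0 $ j $ p j))"
  have "((\<lambda>t. det (P t)) has_real_derivative (\<Sum>p\<in>{p. p permutes (UNIV::'d set)}. ?G p)) (at t0)"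
    unfolding det_def
    by (intro DERIV_sum DERIV_cmult has_field_derivative_prod d)
  also have "(\<Sum>p\<in>{p. p permutes (UNIV::'d set)}. ?G p) = (\<Sum>p\<in>{id}. ?G p)"
  proof (rule sum.mono_neutral_right)
    show "\<forall>p\<in>{p. p permutes UNIV} - {id}. ?G p = 0"
    proof
      fix p :: "'d \<Rightarrow> 'd" assume p: "p \<in> {p. p permutes UNIV} - {id}"
      have "(\<Prod>j\<in>UNIV - {i}. P t0 $ j $ p j) = 0" for i
      proof -
        have "\<exists>j. j \<noteq> i \<and> p j \<noteq> j"
        proof (rule ccontr)
          assume "\<not> ?thesis"
          then have "p j = j" if "j \<noteq> i" for j using that by blast
          moreover have "p i = i"
            using calculation p by (metis DiffD1 injD mem_Collect_eq permutes_inj)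
          ultimately have "p = id" by (metis eq_id_iff)
          then show False using p by simp
        qed
        then obtain j where "j \<noteq> i" "p j \<noteq> j" by blast
        then show ?thesis by (intro prod_zero) (auto simp: P0 mat_def intro!: bexI[of _ j])
      qed
      then show "?G p = 0" by (simp del: prod_zero_iff)
    qed
  qed (auto simp: permutes_id finite_permutations)
  also have "\<dots> = trace P'"
    by (simp add: P0 mat_def trace_def sign_id)
  finally show ?thesis .
qed

text \<open>
  \<open>M t = exp (t P)\<close> is a one-parameter group, and by \<open>P\<^sup>3 = -P\<close> it is given by the Rodrigues formula
  below and has period \<open>2 \<pi>\<close>. Its determinant satisfies \<open>f' = f trace P\<close> and takes the same value at
  \<open>0\<close> and \<open>2 \<pi>\<close>; Rolle's theorem yields a zero of \<open>f'\<close>, whereas \<open>f\<close> has none.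
\<close>

lemma trace_zero_if_cube_eq_minus:
  fixes P :: "real^'d^'d"
  assumes P3: "P ** (P ** P) = - P"
  shows "trace P = 0"
proof -
  define Q where "Q = P ** P"
  define M where "M t = mat 1 + sin t *\<^sub>R P + (1 - cos t) *\<^sub>R Q" for t
  have P3v: "P *v (P *v (P *v u)) = - (P *v u)" for u
    using arg_cong[OF P3, of "\<lambda>B. B *v u"] scaleR_matrix_vector_assoc[of "-1" P u]
    by (simp add: matrix_vector_mul_assoc[symmetric])
  have Pneg: "P *v (- u) = - (P *v u)" for u
    using matrix_vector_mult_scaleR[of P "-1" u] by simp
  have Mv: "M t *v u = u + sin t *\<^sub>R (P *v u) + (1 - cos t) *\<^sub>R (P *v (P *v u))" for t u
    by (simp add: M_def Q_def matrix_vector_mult_add_rdistrib matrix_vector_mul_assoc flip: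
      scaleR_matrix_vector_assoc)
  have "M s ** M t = M (s + t)" for s t
  proof -
    have "(M s ** M t) *v u = M (s + t) *v u" for u
      by (simp add: matrix_vector_mul_assoc[symmetric] Mv matrix_vector_right_distrib
          matrix_vector_mult_scaleR P3v Pneg sin_add cos_add algebra_simps)
    then show ?thesis by (simp add: matrix_eq)
  qed
  then have mult: "det (M (s + t)) = det (M s) * det (M t)" for s t
    by (simp flip: det_mul)
  have M0: "M 0 = mat 1" "M (2 * pi) = mat 1" by (simp_all add: M_def)
  have d0: "((\<lambda>t. det (M t)) has_real_derivative trace P) (at 0)"
    by (rule det_id_plus_derivative) (auto simp: M_def intro!: derivative_eq_intros)
  \<comment> \<open>the derivative at \<open>0\<close>, transported by the group law\<close>
  have d: "((\<lambda>t. det (M t)) has_real_derivative det (M t) * trace P) (at t)" for t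
  proof -
    have "((\<lambda>u. det (M (u - t))) has_real_derivative trace P) (at t)"
      using DERIV_shift[of "\<lambda>u. det (M u)" "trace P" t "- t"] d0 by simp
    then have "((\<lambda>u. det (M t) * det (M (u - t))) has_real_derivative det (M t) * trace P) (at t)"
      by (rule DERIV_cmult)
    then show ?thesis by (simp flip: mult)
  qed
  have "\<exists>z. 0 < z \<and> z < 2 * pi \<and> (*) (det (M z) * trace P) = (\<lambda>v. 0)"
  proof (rule Rolle_deriv)
    show "continuous_on {0..2 * pi} (\<lambda>t. det (M t))"
      using d by (meson DERIV_isCont continuous_at_imp_continuous_on)
    show "((\<lambda>t. det (M t)) has_derivative (*) (det (M z) * trace P)) (at z)" for z
      using d[of z] by (simp add: has_field_derivative_def)
  qed (simp_all add: M0)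
  then obtain z where "det (M z) * trace P = 0" by (metis mult.right_neutral)
  moreover have "det (M z) \<noteq> 0"
    using mult[of z "- z"] by (auto simp: M0)
  ultimately show ?thesis by simp
qed

section \<open>Sasaki-like manifolds\<close>

locale sasaki_like_manifold =
  fixes n :: nat and A :: "('m::{t2_space, second_countable_topology}, 'd::finite) atlas"
    and \<phi> \<xi> \<eta> g D
  assumes contact: "almost_contact_B_metric n A \<phi> \<xi> \<eta> g"
    and levi_civita: "levi_civita A g D"
    and sasaki: "sasaki_like A \<phi> \<xi> \<eta> g D"
begin

sublocale smooth_manifold A
  using contact by unfold_locales (simp add: almost_contact_B_metric_def)

sublocale metric_field A g
  by (rule pseudo_riemannian_metric_field[of "n + 1" n])
    (use contact in \<open>simp add: almost_contact_B_metric_def\<close>)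

sublocale levi_civita_connection A g D
  by (rule levi_civita_connectionI[OF levi_civita])

lemma phi_tangent [simp]: "x \<in> tangent_space A p \<Longrightarrow> \<phi> p x \<in> tangent_space A p"
  using contact unfolding almost_contact_B_metric_def endo_field_def by blast

lemma phi_add [simp]: "x \<in> tangent_space A p \<Longrightarrow> y \<in> tangent_space A p \<Longrightarrow> \<phi> p (x + y) = \<phi> p x + \<phi> p y"
  using contact unfolding almost_contact_B_metric_def endo_field_def by blast

lemma phi_scale [simp]: "x \<in> tangent_space A p \<Longrightarrow> \<phi> p (c *\<^sub>R x) = c *\<^sub>R \<phi> p x"
  using contact unfolding almost_contact_B_metric_def endo_field_def by blast

lemma phi_minus [simp]: "x \<in> tangent_space A p \<Longrightarrow> \<phi> p (- x) = - \<phi> p x"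
  using phi_scale[of x p "-1"] by simp

lemma phi_diff [simp]: "x \<in> tangent_space A p \<Longrightarrow> y \<in> tangent_space A p \<Longrightarrow> \<phi> p (x - y) = \<phi> p x - \<phi> p y"
  using phi_add[of x p "- y"] by simp

lemma phi_sum: "(\<And>i. i \<in> I \<Longrightarrow> x i \<in> tangent_space A p) \<Longrightarrow> \<phi> p (\<Sum>i\<in>I. x i) = (\<Sum>i\<in>I. \<phi> p (x i))"
proof (induction I rule: infinite_finite_induct)
  case empty
  show ?case using phi_scale[of 0 p 0] by simp
qed (use phi_scale[of 0 _ 0] in auto)

lemma phi_vfield [simp]: "open U \<Longrightarrow> X \<in> vfields A U \<Longrightarrow> (\<lambda>q. \<phi> q (X q)) \<in> vfields A U"
  using contact unfolding almost_contact_B_metric_def endo_field_def by blast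

lemma xi_vfield [simp]: "\<xi> \<in> vfields A U"
  using contact vfields_subset[of \<xi> UNIV U] by (simp add: almost_contact_B_metric_def)

lemma xi_tangent [simp]: "\<xi> p \<in> tangent_space A p"
  using vfields_tangent[OF xi_vfield UNIV_I] .

lemma eta_add [simp]: "x \<in> tangent_space A p \<Longrightarrow> y \<in> tangent_space A p \<Longrightarrow> \<eta> p (x + y) = \<eta> p x + \<eta> p y"
  using contact unfolding almost_contact_B_metric_def one_form_def by blast

lemma eta_scale [simp]: "x \<in> tangent_space A p \<Longrightarrow> \<eta> p (c *\<^sub>R x) = c * \<eta> p x"
  using contact unfolding almost_contact_B_metric_def one_form_def by blast

lemma eta_minus [simp]: "x \<in> tangent_space A p \<Longrightarrow> \<eta> p (- x) = - \<eta> p x"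
  using eta_scale[of x p "-1"] by simp

lemma eta_diff [simp]: "x \<in> tangent_space A p \<Longrightarrow> y \<in> tangent_space A p \<Longrightarrow> \<eta> p (x - y) = \<eta> p x - \<eta> p y"
  using eta_add[of x p "- y"] by simp

lemma eta_smooth: "open U \<Longrightarrow> X \<in> vfields A U \<Longrightarrow> (\<lambda>q. \<eta> q (X q)) \<in> smooth_funs A U"
  using contact unfolding almost_contact_B_metric_def one_form_def by blast

lemma phi_xi [simp]: "\<phi> p (\<xi> p) = 0" and eta_xi [simp]: "\<eta> p (\<xi> p) = 1"
  using contact by (simp_all add: almost_contact_B_metric_def)

lemma phi_phi [simp]: "x \<in> tangent_space A p \<Longrightarrow> \<phi> p (\<phi> p x) = - x + \<eta> p x *\<^sub>R \<xi> p"
  using contact unfolding almost_contact_B_metric_def by blast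

lemma eta_phi [simp]: "x \<in> tangent_space A p \<Longrightarrow> \<eta> p (\<phi> p x) = 0"
  using contact unfolding almost_contact_B_metric_def by blast

lemma g_phi_phi: "x \<in> tangent_space A p \<Longrightarrow> y \<in> tangent_space A p \<Longrightarrow>
    g p (\<phi> p x) (\<phi> p y) = - g p x y + \<eta> p x * \<eta> p y"
  using contact unfolding almost_contact_B_metric_def by blast

lemma g_xi_right [simp]: "x \<in> tangent_space A p \<Longrightarrow> g p x (\<xi> p) = \<eta> p x"
  using g_phi_phi[of x p "\<xi> p"] by simp

lemma g_xi_left [simp]: "x \<in> tangent_space A p \<Longrightarrow> g p (\<xi> p) x = \<eta> p x"
  using form_sym[of "\<xi> p" p x] by simp

lemma g_phi_left [simp]: "x \<in> tangent_space A p \<Longrightarrow> y \<in> tangent_space A p \<Longrightarrow>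
    g p (\<phi> p x) y = g p x (\<phi> p y)"
  using g_phi_phi[of "\<phi> p x" p y] by simp

lemma g_phi_sym: "x \<in> tangent_space A p \<Longrightarrow> y \<in> tangent_space A p \<Longrightarrow>
    g p x (\<phi> p y) = g p y (\<phi> p x)"
  using form_sym[of "\<phi> p x" p y] by simp

context
  fixes U :: "'m set"
  assumes U [simp]: "open U"
begin

lemma D_tangent [simp]: "X \<in> vfields A U \<Longrightarrow> Y \<in> vfields A U \<Longrightarrow> p \<in> U \<Longrightarrow> D X Y p \<in> tangent_space A p"
  by (rule vfields_tangent[OF D_vfield[OF U]])

lemma vfield_at [simp]: "X \<in> vfields A U \<Longrightarrow> p \<in> U \<Longrightarrow> X p \<in> tangent_space A p"
  by (rule vfields_tangent)

lemma D_phi: "X \<in> vfields A U \<Longrightarrow> Y \<in> vfields A U \<Longrightarrow> p \<in> U \<Longrightarrow>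
    D X (\<lambda>q. \<phi> q (Y q)) p = \<phi> p (D X Y p) - g p (X p) (Y p) *\<^sub>R \<xi> p - \<eta> p (Y p) *\<^sub>R X p
      + (2 * \<eta> p (X p) * \<eta> p (Y p)) *\<^sub>R \<xi> p"
proof -
  assume *: "X \<in> vfields A U" "Y \<in> vfields A U" "p \<in> U"
  have "D X (\<lambda>q. \<phi> q (Y q)) p - \<phi> p (D X Y p) =
      - (g p (X p) (Y p) *\<^sub>R \<xi> p) - \<eta> p (Y p) *\<^sub>R X p + (2 * \<eta> p (X p) * \<eta> p (Y p)) *\<^sub>R \<xi> p"
    using sasaki * U unfolding sasaki_like_def by blast
  then show ?thesis by (simp add: algebra_simps)
qed

text \<open>
  The Sasaki-like condition for \<open>y = \<xi>\<close> gives \<open>\<phi>(D\<^sub>X \<xi>) = X - \<eta>(X) \<xi>\<close>, and \<open>\<xi>\<close> having constant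
  length gives \<open>\<eta>(D\<^sub>X \<xi>) = 0\<close>.
\<close>

lemma D_xi:
  assumes "X \<in> vfields A U" "p \<in> U"
  shows "D X \<xi> p = - \<phi> p (X p)"
proof -
  let ?y = "D X \<xi> p"
  have T: "?y \<in> tangent_space A p" "X p \<in> tangent_space A p" using assms by simp_all
  have "dir (X p) (\<lambda>q. g q (\<xi> q) (\<xi> q)) = 0"
    using dir_const[OF T(2), of 1] by simp
  then have "\<eta> p ?y = 0"
    using compat[OF U xi_vfield xi_vfield assms] T by simp
  moreover have F: "0 = \<phi> p ?y - \<eta> p (X p) *\<^sub>R \<xi> p - X p + (2 * \<eta> p (X p)) *\<^sub>R \<xi> p"
    using D_phi[OF assms(1) xi_vfield assms(2)] D_zero_right[OF U assms] T by simp
  have "\<phi> p ?y = X p - \<eta> p (X p) *\<^sub>R \<xi> p"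
    by (rule tvec_eqI) (use arg_cong[OF F, of "\<lambda>t. dir t f" for f] in \<open>simp add: algebra_simps\<close>)
  then have "\<phi> p (\<phi> p ?y) = \<phi> p (X p)"
    using T by simp
  ultimately have "- ?y = \<phi> p (X p)" using T by simp
  then show ?thesis by (metis minus_minus)
qed

lemma dir_eta:
  assumes "X \<in> vfields A U" "Y \<in> vfields A U" "p \<in> U"
  shows "dir (X p) (\<lambda>q. \<eta> q (Y q)) = \<eta> p (D X Y p) - g p (X p) (\<phi> p (Y p))"
proof -
  have "dir (X p) (\<lambda>q. \<eta> q (Y q)) = dir (X p) (\<lambda>q. g q (Y q) (\<xi> q))"
    using assms by (intro dir_cong[of _ p U]) simp_all
  then show ?thesis
    using compat[OF U assms(2) xi_vfield assms(1,3)] assms by (simp add: D_xi g_phi_sym)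
qed

lemma curv_xi:
  assumes "X \<in> vfields A U" "Y \<in> vfields A U" "p \<in> U"
  shows "curv A D X Y \<xi> p = \<eta> p (Y p) *\<^sub>R X p - \<eta> p (X p) *\<^sub>R Y p"
proof -
  have *: "D X (D Y \<xi>) p = - (\<phi> p (D X Y p) - g p (X p) (Y p) *\<^sub>R \<xi> p - \<eta> p (Y p) *\<^sub>R X p
      + (2 * \<eta> p (X p) * \<eta> p (Y p)) *\<^sub>R \<xi> p)" if "X \<in> vfields A U" "Y \<in> vfields A U" for X Y
  proof -
    have "D X (D Y \<xi>) p = D X (\<lambda>q. - \<phi> q (Y q)) p"
      using that assms by (intro D_cong_right[OF U]) (simp_all add: D_xi vfields_minus)
    then show ?thesis using that assms by (simp add: D_minus_right[OF U] D_phi)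
  qed
  show ?thesis
    using assms form_sym[of "X p" p "Y p"] by
      (simp add: curv_def * D_xi torsion[OF U] algebra_simps)
qed

end

text \<open>
  The value expected from the pair symmetry of \<open>R\<close> and \<open>curv_xi\<close>. In place of pair symmetry, for the
  difference \<open>E\<close> to this value \<open>g(E(X, Y), Z)\<close> is shown to be symmetric in \<open>X\<close>, \<open>Y\<close> by the Bianchi
  identity and skew in \<open>Y\<close>, \<open>Z\<close> by \<open>curv_skew_metric\<close>.
\<close>

lemma curv_xi_left:
  assumes U: "open U" and "X \<in> vfields A U" "Y \<in> vfields A U" "p \<in> U"
  shows "curv A D \<xi> X Y p = g p (X p) (Y p) *\<^sub>R \<xi> p - \<eta> p (Y p) *\<^sub>R X p"
proof -
  obtain V x where Vx: "(V, x) \<in> A" "p \<in> V" by (rule chart_exists)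
  define N where "N = U \<inter> V"
  have N: "open N" "N \<subseteq> V" "p \<in> N" using U Vx chart_open assms by (auto simp: N_def)
  have XY: "X \<in> vfields A N" "Y \<in> vfields A N" using assms vfields_subset by (auto simp: N_def)
  define E where "E X Y = curv A D \<xi> X Y p - (g p (X p) (Y p) *\<^sub>R \<xi> p - \<eta> p (Y p) *\<^sub>R X p)" for X Y
  have T: "curv A D X Y Z p \<in> tangent_space A p" "X p \<in> tangent_space A p"
    if "X \<in> vfields A N" "Y \<in> vfields A N" "Z \<in> vfields A N" for X Y Z
    using vfields_tangent[OF curv_vfield[OF N(1) that] N(3)] vfields_tangent[OF that(1) N(3)] .
  have ET: "E X Y \<in> tangent_space A p" if "X \<in> vfields A N" "Y \<in> vfields A N" for X Y
    unfolding E_def using T that by (simp del: vfields_tangent vfield_at)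
  have "E X Y = 0"
  proof (rule nondeg[OF ET[OF XY]])
    fix s assume "s \<in> tangent_space A p"
    then obtain Z where Z: "Z \<in> vfields A N" "Z p = s"
      using vfield_through[OF Vx(1) N(2,3)] by blast
    have "g p (E X Y) (Z p) = 0"
    proof (rule symmetric_skew_zero[where S = "vfields A N" and B = "\<lambda>X Y Z. g p (E X Y) (Z p)"])
      fix X Y Z assume vf: "X \<in> vfields A N" "Y \<in> vfields A N" "Z \<in> vfields A N"
      show "g p (E X Y) (Z p) = g p (E Y X) (Z p)"
      proof -
        have "curv A D \<xi> X Y p = curv A D \<xi> Y X p - curv A D X Y \<xi> p"
          using bianchi[OF N(1) xi_vfield vf(1,2) N(3)] curv_skew[OF N(1) vf(2) xi_vfield vf(1)
            N(3)]
          by (simp add: algebra_simps)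
        then show ?thesis
          using vf N T form_sym[of "X p" p "Y p"] by
            (simp add: E_def curv_xi[OF N(1)] algebra_simps del: vfields_tangent vfield_at)
      qed
      show "g p (E X Y) (Z p) = - g p (E X Z) (Y p)"
        using vf N T curv_skew_metric[OF N(1) xi_vfield vf N(3)] form_sym[of "X p" p "Y p"]
          form_sym[of "X p" p "Z p"]
        by (simp add: E_def algebra_simps del: vfields_tangent vfield_at)
    qed (use XY Z in auto)
    then show "g p (E X Y) s = 0" using Z by simp
  qed
  then show ?thesis by (simp add: E_def)
qed

end

section \<open>Invariance of the Ricci tensor along the Reeb field\<close>

context torsion_free_connection
begin

text \<open>
  The derivative of a trace along \<open>v\<close> is the trace of the Lie derivative. Neither \<open>\<L>\<^sub>v \<partial>\<^sub>k\<close> nor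
  \<open>\<L>\<^sub>v dx\<^sup>k\<close> vanishes, but both are given by the derivatives \<open>\<partial>\<^sub>i v\<^sup>k\<close> of the components
  of \<open>v\<close>, with opposite signs, and the two double sums cancel.
\<close>

lemma dir_trace_curv:
  assumes Vx: "(V, x) \<in> A" and U: "open U" "U \<subseteq> V" and p: "p \<in> U"
    and vf: "v \<in> vfields A U" "Y \<in> vfields A U" "Z \<in> vfields A U"
  shows "dir (v p) (\<lambda>q. \<Sum>k\<in>UNIV. dir (curv A D (coord_frame V x k) Y Z q) (coord x k)) =
    (\<Sum>k\<in>UNIV. dir (lie_bracket A v (curv A D (coord_frame V x k) Y Z) p
      - curv A D (lie_bracket A v (coord_frame V x k)) Y Z p) (coord x k))"
proof -
  let ?e = "coord_frame V x"
  define r where "r k = curv A D (?e k) Y Z" for k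
  define c where "c k q = dir (v q) (coord x k)" for k q
  have pV: "p \<in> V" using p U by blast
  have e: "?e k \<in> vfields A U" for k by (rule coord_frame_vfield[OF Vx U(2)])
  have r: "r k \<in> vfields A U" for k unfolding r_def by (intro curv_vfield U vf e)
  have T: "r k p \<in> tangent_space A p" "v p \<in> tangent_space A p" "?e k p \<in> tangent_space A p" for k
    using vfields_tangent[OF r p] vfields_tangent[OF vf(1) p] vfields_tangent[OF e p] .
  have xs: "coord x k \<in> smooth_funs A U" for k by (rule coord_smooth[OF Vx U])
  have at: "smooth_at A p (coord x k)" for k by (rule smooth_atI[OF xs U(1) p])
  have exp: "curv A D (lie_bracket A v (?e k)) Y Z p = (\<Sum>i\<in>UNIV. (- dir (?e k p) (c i)) *\<^sub>R r i p)"
    for k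
  proof -
    have "dir (lie_bracket A v (?e k) p) (coord x i) = - dir (?e k p) (c i)" for i
    proof -
      have "dir (v p) (\<lambda>q. dir (?e k q) (coord x i)) = dir (v p) (\<lambda>q. if k = i then 1 else 0)"
        using U dir_coord_frame_coord[OF Vx] by (intro dir_cong[OF T(2) U(1) p]) auto
      then show ?thesis
        using dir_const[OF T(2)] by (simp add: dir_lie_bracket[OF at] c_def[abs_def])
    qed
    then show ?thesis
      using curv_expand[OF U(1) bracket_vfield[OF U(1) vf(1) e] vf(2,3) p Vx U(2)] by
        (simp add: r_def)
  qed
  have comp: "dir (r i p) (c j) = (\<Sum>k\<in>UNIV. dir (r i p) (coord x k) * dir (?e k p) (c j))" for i j
    by (subst coord_frame_expand[OF Vx pV T(1)[of i]]) (simp add: dir_sum)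
  have "dir (v p) (\<lambda>q. \<Sum>k\<in>UNIV. dir (r k q) (coord x k)) =
    (\<Sum>k\<in>UNIV. dir (v p) (\<lambda>q. dir (r k q) (coord x k)))"
    by (intro dir_fsum[OF T(2) U(1) p] vfields_dir[OF r U(1) order_refl xs])
  also have "\<dots> = (\<Sum>k\<in>UNIV. dir (lie_bracket A v (r k) p) (coord x k)) +
    (\<Sum>k\<in>UNIV. dir (r k p) (c k))"
    by (simp add: dir_lie_bracket[OF at] c_def[abs_def] flip: sum.distrib)
  also have "(\<Sum>k\<in>UNIV. dir (r k p) (c k)) =
    (\<Sum>k\<in>UNIV. \<Sum>i\<in>UNIV. dir (?e k p) (c i) * dir (r i p) (coord x k))"
    by (subst sum.swap) (simp add: comp mult.commute)
  also have "\<dots> = - (\<Sum>k\<in>UNIV. dir (curv A D (lie_bracket A v (?e k)) Y Z p) (coord x k))"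
    by (simp add: exp dir_sum flip: sum_negf)
  finally show ?thesis by (simp add: r_def sum_subtractf)
qed

end

context sasaki_like_manifold
begin

text \<open>
  A family closed under the two operations that occur: composing one slot with \<open>\<phi>\<close>
  (\<open>horizontal_form_phi_left\<close>) and covariant differentiation (\<open>dir_horizontal_form\<close>) both amount
  to a quarter turn of the pair \<open>(s, t)\<close>, the latter with a factor \<open>\<eta>\<close> split off.
\<close>

definition horizontal_form :: "real \<Rightarrow> real \<Rightarrow> 'm \<Rightarrow> 'm tvec \<Rightarrow> 'm tvec \<Rightarrow> real" where
  "horizontal_form s t p x y = s * (g p x y - \<eta> p x * \<eta> p y) + t * g p x (\<phi> p y)"

text \<open>
  The expression \<open>(D\<^sub>X W)(Y, Z) - (D\<^sub>Y W)(X, Z)\<close> for \<open>W = T \<xi>\<close>, with the terms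
  \<open>T(D\<^sub>X Y, Z) - T(D\<^sub>Y X, Z)\<close> combined to \<open>T([X, Y], Z)\<close>.
\<close>

definition curv_variation :: "real \<Rightarrow> real \<Rightarrow> 'm vfield \<Rightarrow> 'm vfield \<Rightarrow> 'm vfield \<Rightarrow> 'm vfield" where
  "curv_variation s t X Y Z p =
     D X (\<lambda>q. horizontal_form s t q (Y q) (Z q) *\<^sub>R \<xi> q) p
     - D Y (\<lambda>q. horizontal_form s t q (X q) (Z q) *\<^sub>R \<xi> q) p
     + (horizontal_form s t p (X p) (D Y Z p) - horizontal_form s t p (Y p) (D X Z p)
        - horizontal_form s t p (lie_bracket A X Y p) (Z p)) *\<^sub>R \<xi> p"

lemma horizontal_form_add_left [simp]: "x \<in> tangent_space A p \<Longrightarrow> y \<in> tangent_space A p \<Longrightarrow>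
  z \<in> tangent_space A p \<Longrightarrow>
    horizontal_form s t p (x + y) z = horizontal_form s t p x z + horizontal_form s t p y z"
  by (simp add: horizontal_form_def algebra_simps)

lemma horizontal_form_diff_left [simp]: "x \<in> tangent_space A p \<Longrightarrow> y \<in> tangent_space A p \<Longrightarrow>
  z \<in> tangent_space A p \<Longrightarrow>
    horizontal_form s t p (x - y) z = horizontal_form s t p x z - horizontal_form s t p y z"
  by (simp add: horizontal_form_def algebra_simps)

lemma horizontal_form_sym: "x \<in> tangent_space A p \<Longrightarrow> y \<in> tangent_space A p \<Longrightarrow>
  horizontal_form s t p x y = horizontal_form s t p y x"
  using form_sym[of x p y] g_phi_sym[of x p y] by (simp add: horizontal_form_def)

lemma horizontal_form_add_right [simp]: "x \<in> tangent_space A p \<Longrightarrow> y \<in> tangent_space A p \<Longrightarrow>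
  z \<in> tangent_space A p \<Longrightarrow>
    horizontal_form s t p z (x + y) = horizontal_form s t p z x + horizontal_form s t p z y"
  by (simp add: horizontal_form_def algebra_simps)

lemma horizontal_form_phi_left [simp]: "x \<in> tangent_space A p \<Longrightarrow> y \<in> tangent_space A p \<Longrightarrow>
    horizontal_form s t p (\<phi> p x) y = - horizontal_form t (- s) p x y"
  by (simp add: horizontal_form_def algebra_simps)

lemma horizontal_form_xi [simp]: "y \<in> tangent_space A p \<Longrightarrow> horizontal_form s t p (\<xi> p) y = 0"
  by (simp add: horizontal_form_def)

context
  fixes U :: "'m set"
  assumes U [simp]: "open U"
begin

lemma horizontal_form_smooth: "X \<in> vfields A U \<Longrightarrow> Y \<in> vfields A U \<Longrightarrow>
  (\<lambda>q. horizontal_form s t q (X q) (Y q)) \<in> smooth_funs A U"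
  unfolding horizontal_form_def
  by (intro smooth_funs_add smooth_funs_mult smooth_funs_diff smooth_funs_const form_smooth
    eta_smooth phi_vfield U)

lemma horizontal_form_xi_vfield [simp]: "X \<in> vfields A U \<Longrightarrow> Y \<in> vfields A U \<Longrightarrow>
  (\<lambda>q. horizontal_form s t q (X q) (Y q) *\<^sub>R \<xi> q) \<in> vfields A U"
  by (intro vfields_scale horizontal_form_smooth xi_vfield)

lemma dir_horizontal_form:
  assumes "X \<in> vfields A U" "Y \<in> vfields A U" "Z \<in> vfields A U" "p \<in> U"
  shows "dir (X p) (\<lambda>q. horizontal_form s t q (Y q) (Z q)) =
    horizontal_form s t p (D X Y p) (Z p) + horizontal_form s t p (Y p) (D X Z p)
    + \<eta> p (Y p) * horizontal_form (- t) s p (X p) (Z p) +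
      \<eta> p (Z p) * horizontal_form (- t) s p (X p) (Y p)"
proof -
  have T: "X p \<in> tangent_space A p" "Y p \<in> tangent_space A p" "Z p \<in> tangent_space A p"
    "D X Y p \<in> tangent_space A p" "D X Z p \<in> tangent_space A p"
    using assms vfields_tangent D_tangent[OF U] by blast+
  note sm = smooth_funs_add smooth_funs_mult smooth_funs_diff smooth_funs_const form_smooth
    eta_smooth phi_vfield U
  have gg: "(\<lambda>q. g q (Y q) (Z q)) \<in> smooth_funs A U" "(\<lambda>q. g q (Y q) (\<phi> q (Z q))) \<in> smooth_funs A U"
    "(\<lambda>q. \<eta> q (Y q)) \<in> smooth_funs A U" "(\<lambda>q. \<eta> q (Z q)) \<in> smooth_funs A U"
    "(\<lambda>q. \<eta> q (Y q) * \<eta> q (Z q)) \<in> smooth_funs A U"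
    "(\<lambda>q. g q (Y q) (Z q) - \<eta> q (Y q) * \<eta> q (Z q)) \<in> smooth_funs A U"
    by (intro sm assms)+
  have "dir (X p) (\<lambda>q. horizontal_form s t q (Y q) (Z q)) =
      s * (dir (X p) (\<lambda>q. g q (Y q) (Z q)) - (dir (X p) (\<lambda>q. \<eta> q (Y q)) * \<eta> p (Z p) +
        \<eta> p (Y p) * dir (X p) (\<lambda>q. \<eta> q (Z q))))
      + t * dir (X p) (\<lambda>q. g q (Y q) (\<phi> q (Z q)))"
    unfolding horizontal_form_def
    using gg by (simp add: dir_plus[OF T(1) U assms(4) smooth_funs_mult smooth_funs_mult]
      smooth_funs_const
        dir_cmult[OF T(1) U assms(4)] dir_diff[OF T(1) U assms(4)] dir_times[OF T(1) U assms(4)])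
  also have "dir (X p) (\<lambda>q. g q (Y q) (Z q)) = g p (D X Y p) (Z p) + g p (Y p) (D X Z p)"
    using assms by (simp add: compat[OF U])
  also have "dir (X p) (\<lambda>q. g q (Y q) (\<phi> q (Z q))) = g p (D X Y p) (\<phi> p (Z p)) +
    g p (Y p) (D X (\<lambda>q. \<phi> q (Z q)) p)"
    by (rule compat[OF U assms(2) phi_vfield[OF U assms(3)] assms(1,4)])
  finally show ?thesis
    using assms T form_sym[of "Y p" p "X p"]
    by (simp add: dir_eta[OF U] D_phi[OF U] horizontal_form_def del: vfields_tangent vfield_at)
      (simp add: algebra_simps)
qed

lemma curv_variation_eq:
  assumes "X \<in> vfields A U" "Y \<in> vfields A U" "Z \<in> vfields A U" "p \<in> U"
  shows "curv_variation s t X Y Z p =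
    (\<eta> p (X p) * horizontal_form t (- s) p (Y p) (Z p) - \<eta> p (Y p) * horizontal_form t (- s) p (X
      p) (Z p)) *\<^sub>R \<xi> p
    - horizontal_form s t p (Y p) (Z p) *\<^sub>R \<phi> p (X p) +
      horizontal_form s t p (X p) (Z p) *\<^sub>R \<phi> p (Y p)"
proof -
  have T: "X p \<in> tangent_space A p" "Y p \<in> tangent_space A p" "Z p \<in> tangent_space A p"
    "D X Y p \<in> tangent_space A p" "D X Z p \<in> tangent_space A p" "D Y X p \<in> tangent_space A p"
    using assms vfields_tangent D_tangent[OF U] by blast+
  have neg: "horizontal_form (- t) s p x y = - horizontal_form t (- s) p x y" for x y
    by (simp add: horizontal_form_def algebra_simps)
  show ?thesis
    using assms T horizontal_form_sym[OF T(1,2)]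
    by (intro tvec_eqI) (simp add: curv_variation_def D_scale_right[OF U] horizontal_form_smooth
      D_xi[OF U] dir_horizontal_form torsion[OF U] neg algebra_simps)
qed

end

context
  fixes V x U p
  assumes Vx: "(V, x) \<in> A" and U: "open U" "U \<subseteq> V" and p: "p \<in> U"
begin

text \<open>
  The trace of the endomorphism \<open>x \<mapsto> g(x, w) u\<close>.
\<close>

lemma trace_rank_one:
  assumes "u \<in> tangent_space A p" "w \<in> tangent_space A p"
  shows "(\<Sum>k\<in>UNIV. g p (coord_frame V x k p) w * dir u (coord x k)) = g p u w"
proof -
  have pV: "p \<in> V" using p U by blast
  have "g p u w = g p (\<Sum>k\<in>UNIV. dir u (coord x k) *\<^sub>R coord_frame V x k p) w"
    using coord_frame_expand[OF Vx pV assms(1)] by simp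
  also have "\<dots> = (\<Sum>k\<in>UNIV. g p (coord_frame V x k p) w * dir u (coord x k))"
    using assms coord_frame_tangent[OF Vx pV] by (simp add: form_sum_left mult.commute)
  finally show ?thesis by simp
qed

lemma trace_phi: "(\<Sum>k\<in>UNIV. dir (\<phi> p (coord_frame V x k p)) (coord x k)) = 0"
proof -
  have pV: "p \<in> V" using p U by blast
  note T = coord_frame_tangent[OF Vx pV]
  define P :: "real^'d^'d" where "P = (\<chi> j k. dir (\<phi> p (coord_frame V x k p)) (coord x j))"
  define c :: "'m tvec \<Rightarrow> real^'d" where "c t = (\<chi> i. dir t (coord x i))" for t
  have Pc: "P *v c t = c (\<phi> p t)" if "t \<in> tangent_space A p" for t
  proof -
    have "\<phi> p t = \<phi> p (\<Sum>k\<in>UNIV. dir t (coord x k) *\<^sub>R coord_frame V x k p)"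
      using coord_frame_expand[OF Vx pV that] by simp
    also have "\<dots> = (\<Sum>k\<in>UNIV. dir t (coord x k) *\<^sub>R \<phi> p (coord_frame V x k p))"
      using T by (simp add: phi_sum)
    finally show ?thesis
      by (simp add: vec_eq_iff P_def c_def matrix_vector_mult_def dir_sum mult.commute)
  qed
  have "(P ** (P ** P)) *v u = (- P) *v u" for u
  proof -
    define t where "t = (\<Sum>k\<in>UNIV. u $ k *\<^sub>R coord_frame V x k p)"
    have t: "t \<in> tangent_space A p" using T by (auto simp: t_def)
    have u: "u = c t"
      using pV by (simp add: t_def c_def vec_eq_iff dir_sum dir_coord_frame_coord[OF Vx] if_distrib
        cong: if_cong)
    have "(- P) *v c t = - (P *v c t)"
      by (simp add: vec_eq_iff matrix_vector_mult_def sum_negf)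
    then show ?thesis
      using t by (simp add: u matrix_vector_mul_assoc[symmetric] Pc) (simp add: c_def vec_eq_iff)
  qed
  then have "P ** (P ** P) = - P" by (simp add: matrix_eq)
  then have "trace P = 0" by (rule trace_zero_if_cube_eq_minus)
  then show ?thesis by (simp add: trace_def P_def)
qed

text \<open>
  By \<open>curv_variation_eq\<close> the trace over \<open>X\<close> consists of \<open>T'(Y, Z)\<close>, where \<open>T'\<close> is the quarter turn of
  the form \<open>T\<close>, of a multiple of \<open>T'(\<xi>, Z) = 0\<close>, of a multiple of the trace of \<open>\<phi>\<close>, and of
  \<open>T(\<phi> Y, Z) = -T'(Y, Z)\<close>.
\<close>

lemma trace_curv_variation:
  assumes "Y \<in> vfields A U" "Z \<in> vfields A U"
  shows "(\<Sum>k\<in>UNIV. dir (curv_variation s t (coord_frame V x k) Y Z p) (coord x k)) = 0"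
proof -
  have pV: "p \<in> V" using p U by blast
  note T = coord_frame_tangent[OF Vx pV] vfields_tangent[OF assms(1) p] vfields_tangent[OF assms(2)
    p]
  have e: "coord_frame V x k \<in> vfields A U" for k by (rule coord_frame_vfield[OF Vx U(2)])
  define w where "w s t = s *\<^sub>R (Z p) - (s * \<eta> p (Z p)) *\<^sub>R \<xi> p + t *\<^sub>R \<phi> p (Z p)" for s t
  have w: "w s t \<in> tangent_space A p" for s t using T by (simp add: w_def)
  have tw: "horizontal_form s t p u (Z p) = g p u (w s t)" if "u \<in> tangent_space A p" for s t u
    using that T by (simp add: horizontal_form_def w_def algebra_simps)
  have "(\<Sum>k\<in>UNIV. dir (curv_variation s t (coord_frame V x k) Y Z p) (coord x k)) =
    horizontal_form t (- s) p (Y p) (Z p) * (\<Sum>k\<in>UNIV. g p (coord_frame V x k p) (\<xi> p) * dir (\<xi> p)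
      (coord x k))
    - \<eta> p (Y p) * (\<Sum>k\<in>UNIV. g p (coord_frame V x k p) (w t (- s)) * dir (\<xi> p) (coord x k))
    - horizontal_form s t p (Y p) (Z p) * (\<Sum>k\<in>UNIV. dir (\<phi> p (coord_frame V x k p)) (coord x k))
    + (\<Sum>k\<in>UNIV. g p (coord_frame V x k p) (w s t) * dir (\<phi> p (Y p)) (coord x k))"
    unfolding sum_distrib_left sum_subtractf[symmetric] sum.distrib[symmetric]
    using T by (intro sum.cong refl) (simp add: curv_variation_eq[OF U(1) e assms p] tw[OF T(1)]
      algebra_simps)
  also have "\<dots> = horizontal_form t (- s) p (Y p) (Z p) * g p (\<xi> p) (\<xi> p) - \<eta> p (Y p) *
    horizontal_form t (- s) p (\<xi> p) (Z p)
      + horizontal_form s t p (\<phi> p (Y p)) (Z p)"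
    using T w by (simp only: trace_rank_one trace_phi xi_tangent phi_tangent tw)
  also have "\<dots> = 0" using T by simp
  finally show ?thesis .
qed

end

lemma bracket_xi:
  assumes "open U" "X \<in> vfields A U" "p \<in> U"
  shows "lie_bracket A \<xi> X p = D \<xi> X p + \<phi> p (X p)"
  using assms by (simp add: torsion[of U] D_xi[of U])

text \<open>
  Since \<open>[\<xi>, X] = D\<^sub>\<xi> X + \<phi> X\<close>, the Lie derivative of \<open>D\<close> along \<open>\<xi>\<close> is
  \<open>R(\<xi>, X)Y - (D\<^sub>X \<phi>) Y\<close>; the terms \<open>\<eta>(Y) X\<close> of the two cancel.
\<close>

lemma lie_xi_connection:
  assumes U: "open U" and "X \<in> vfields A U" "Y \<in> vfields A U" "p \<in> U"
  shows "lie_bracket A \<xi> (D X Y) p = D (lie_bracket A \<xi> X) Y p + D X (lie_bracket A \<xi> Y) p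
    + horizontal_form 2 0 p (X p) (Y p) *\<^sub>R \<xi> p"
proof -
  have T: "X p \<in> tangent_space A p" "Y p \<in> tangent_space A p" "D X Y p \<in> tangent_space A p"
    using assms vfields_tangent D_tangent[OF U] by blast+
  have "D X (lie_bracket A \<xi> Y) p = D X (\<lambda>q. D \<xi> Y q + \<phi> q (Y q)) p"
    using assms by (intro D_cong_right[OF U]) (simp_all add: vfields_add bracket_xi)
  also have "\<dots> = D X (D \<xi> Y) p + D X (\<lambda>q. \<phi> q (Y q)) p"
    using assms by (intro D_add_right[OF U]) simp_all
  finally have 1: "D X (lie_bracket A \<xi> Y) p = D X (D \<xi> Y) p + D X (\<lambda>q. \<phi> q (Y q)) p" .
  have 2: "lie_bracket A \<xi> (D X Y) p = D \<xi> (D X Y) p + \<phi> p (D X Y p)"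
    using assms by (intro bracket_xi[OF U]) simp_all
  have 3: "D \<xi> (D X Y) p = D X (D \<xi> Y) p + D (lie_bracket A \<xi> X) Y p + curv A D \<xi> X Y p"
    by (simp add: curv_def)
  show ?thesis
    unfolding 1 2 3 using assms T
    by (intro tvec_eqI) (simp add: curv_xi_left[of U] D_phi[of U] horizontal_form_def algebra_simps)
qed

text \<open>
  Apply \<open>lie_xi_connection\<close> to each covariant derivative in the definition of the curvature.
\<close>

lemma lie_xi_curv:
  assumes U: "open U" and vf: "X \<in> vfields A U" "Y \<in> vfields A U" "Z \<in> vfields A U" and p: "p \<in> U"
  shows "lie_bracket A \<xi> (curv A D X Y Z) p = curv A D (lie_bracket A \<xi> X) Y Z p
    + curv A D X (lie_bracket A \<xi> Y) Z p + curv A D X Y (lie_bracket A \<xi> Z) p +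
      curv_variation 2 0 X Y Z p"
proof -
  let ?L = "lie_bracket A \<xi>"
  have two: "?L (D X (D Y Z)) p = D (?L X) (D Y Z) p + D X (D (?L Y) Z) p + D X (D Y (?L Z)) p
      + D X (\<lambda>q. horizontal_form 2 0 q (Y q) (Z q) *\<^sub>R \<xi> q) p +
        horizontal_form 2 0 p (X p) (D Y Z p) *\<^sub>R \<xi> p"
    if "X \<in> vfields A U" "Y \<in> vfields A U" for X Y
  proof -
    have "D X (?L (D Y Z)) p = D X (\<lambda>q. (D (?L Y) Z q + D Y (?L Z) q) +
      horizontal_form 2 0 q (Y q) (Z q) *\<^sub>R \<xi> q) p"
      using that U vf p by (intro D_cong_right[OF U] vfields_add lie_xi_connection) simp_all
    also have "\<dots> = D X (D (?L Y) Z) p + D X (D Y (?L Z)) p +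
      D X (\<lambda>q. horizontal_form 2 0 q (Y q) (Z q) *\<^sub>R \<xi> q) p"
      using that U vf p by (simp add: D_add_right[OF U] vfields_add)
    finally show ?thesis
      using that U vf p by (simp add: lie_xi_connection[of U])
  qed
  have "?L (D (lie_bracket A X Y) Z) p = D (?L (lie_bracket A X Y)) Z p +
    D (lie_bracket A X Y) (?L Z) p
      + horizontal_form 2 0 p (lie_bracket A X Y p) (Z p) *\<^sub>R \<xi> p"
    using U vf p by (intro lie_xi_connection) simp_all
  also have "D (?L (lie_bracket A X Y)) Z p = D (\<lambda>q. lie_bracket A (?L X) Y q +
    lie_bracket A X (?L Y) q) Z p"
    using jacobi[OF U xi_vfield vf(1,2)]
    by (intro D_cong_left[OF U] vfields_add bracket_vfield[OF U] xi_vfield vf p)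
  also have "\<dots> = D (lie_bracket A (?L X) Y) Z p + D (lie_bracket A X (?L Y)) Z p"
    by (intro D_add_left[OF U] bracket_vfield[OF U] xi_vfield vf p)
  finally have three: "?L (D (lie_bracket A X Y) Z) p = D (lie_bracket A (?L X) Y) Z p +
    D (lie_bracket A X (?L Y)) Z p
      + D (lie_bracket A X Y) (?L Z) p +
        horizontal_form 2 0 p (lie_bracket A X Y p) (Z p) *\<^sub>R \<xi> p" .
  have "?L (curv A D X Y Z) p = ?L (\<lambda>q. (D X (D Y Z) q - D Y (D X Z) q) - D (lie_bracket A X Y) Z
    q) p"
    by (simp add: curv_def[abs_def])
  also have "\<dots> = ?L (D X (D Y Z)) p - ?L (D Y (D X Z)) p - ?L (D (lie_bracket A X Y) Z) p"
    using U vf p by (simp add: bracket_diff_right[OF U] vfields_diff)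
  finally show ?thesis
    by (simp add: two[OF vf(1,2)] two[OF vf(2,1)] three curv_def curv_variation_def algebra_simps)
qed

text \<open>
  \<open>\<L>\<^sub>\<xi> \<rho> = 0\<close>: trace \<open>lie_xi_curv\<close>.
\<close>

lemma ricci_xi_invariant:
  assumes U: "open U" and vf: "Y \<in> vfields A U" "Z \<in> vfields A U" and p: "p \<in> U"
  shows "dir (\<xi> p) (\<lambda>q. ricci A g D Y Z q) =
    ricci A g D (lie_bracket A \<xi> Y) Z p + ricci A g D Y (lie_bracket A \<xi> Z) p"
proof -
  obtain V x where Vx: "(V, x) \<in> A" "p \<in> V" by (rule chart_exists)
  define N where "N = U \<inter> V"
  have N: "open N" "N \<subseteq> V" "p \<in> N" using U Vx chart_open p by (auto simp: N_def)
  have vfN: "Y \<in> vfields A N" "Z \<in> vfields A N" using vf vfields_subset by (auto simp: N_def)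
  have e: "coord_frame V x k \<in> vfields A N" for k by (rule coord_frame_vfield[OF Vx(1) N(2)])
  have ric: "ricci A g D Y Z q = (\<Sum>k\<in>UNIV. dir (curv A D (coord_frame V x k) Y Z q) (coord x k))"
    if "q \<in> N" "Y \<in> vfields A N" "Z \<in> vfields A N" for q Y Z
    using that N Vx by (intro ricci_trace[OF metric_field_axioms N(1)]) auto
  have "dir (\<xi> p) (\<lambda>q. ricci A g D Y Z q) =
      dir (\<xi> p) (\<lambda>q. \<Sum>k\<in>UNIV. dir (curv A D (coord_frame V x k) Y Z q) (coord x k))"
    using ric vfN by (intro dir_cong[OF xi_tangent N(1,3)]) simp
  also have "\<dots> = (\<Sum>k\<in>UNIV. dir (curv A D (coord_frame V x k) (lie_bracket A \<xi> Y) Z p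
      + curv A D (coord_frame V x k) Y (lie_bracket A \<xi> Z) p +
        curv_variation 2 0 (coord_frame V x k) Y Z p) (coord x k))"
    unfolding dir_trace_curv[OF Vx(1) N xi_vfield vfN]
    by (simp add: lie_xi_curv[OF N(1) e vfN N(3)] algebra_simps)
  also have "\<dots> = ricci A g D (lie_bracket A \<xi> Y) Z p + ricci A g D Y (lie_bracket A \<xi> Z) p"
    using vfN N by (simp add: ric sum.distrib trace_curv_variation[OF Vx(1) N vfN])
  finally show ?thesis .
qed

lemma ricci_xi_xi: "ricci A g D \<xi> \<xi> p = 2 * real n"
proof -
  obtain V x where Vx: "(V, x) \<in> A" "p \<in> V" by (rule chart_exists)
  have V: "open V" using chart_open[OF Vx(1)] by simp
  note T = coord_frame_tangent[OF Vx]
  have "ricci A g D \<xi> \<xi> p = (\<Sum>k\<in>UNIV. dir (curv A D (coord_frame V x k) \<xi> \<xi> p) (coord x k))"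
    using V Vx by (intro ricci_trace[OF metric_field_axioms V]) auto
  also have "\<dots> = (\<Sum>k\<in>UNIV. 1 - g p (coord_frame V x k p) (\<xi> p) * dir (\<xi> p) (coord x k))"
    using T by (intro sum.cong refl)
      (simp add: curv_xi[OF V coord_frame_vfield[OF Vx(1)] xi_vfield Vx(2)]
        dir_coord_frame_coord[OF Vx])
  also have "\<dots> = real CARD('d) - 1"
    using trace_rank_one[OF Vx(1) V order_refl Vx(2), of "\<xi> p" "\<xi> p"] by (simp add: sum_subtractf)
  also have "\<dots> = 2 * real n" using contact by (simp add: almost_contact_B_metric_def)
  finally show ?thesis .
qed

text \<open>
  With \<open>T\<close> the horizontal part of \<open>\<rho>\<close>, invariance along \<open>\<xi>\<close> reads \<open>T(\<phi> Y, Z) + T(Y, \<phi> Z) = 0\<close>,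
  because \<open>g\<close>, \<open>\<phi>\<close> and \<open>\<eta>\<close> are parallel along \<open>\<xi>\<close> and \<open>\<L>\<^sub>\<xi> - D\<^sub>\<xi> = \<phi>\<close> on fields. Both summands
  agree, so \<open>T(\<phi> Y, Z) = 0\<close>, and replacing \<open>Y\<close> by \<open>\<phi> Y\<close> gives \<open>T = 0\<close>.
\<close>

lemma einstein_like_ricci:
  assumes "einstein_like A \<phi> \<eta> g D" and U: "open U" and vf: "Y \<in> vfields A U" "Z \<in> vfields A U"
    and p: "p \<in> U"
  shows "ricci A g D Y Z p = 2 * real n * \<eta> p (Y p) * \<eta> p (Z p)"
proof -
  obtain a b c where E: "\<forall>U. open U \<longrightarrow> (\<forall>X\<in>vfields A U. \<forall>Y\<in>vfields A U. \<forall>p\<in>U.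
        ricci A g D X Y p = a * g p (X p) (Y p) + b * associated_metric \<phi> \<eta> g p (X p) (Y p)
            + c * \<eta> p (X p) * \<eta> p (Y p))"
    using assms(1) unfolding einstein_like_def by (elim exE)
  have ric: "ricci A g D X Y p = horizontal_form a b p (X p) (Y p) + (a + b +
    c) * (\<eta> p (X p) * \<eta> p (Y p))"
    if "X \<in> vfields A U" "Y \<in> vfields A U" "p \<in> U" for X Y p
    using E[rule_format, OF U that] by (simp add: associated_metric_def horizontal_form_def
      algebra_simps)
  \<comment> \<open>the horizontal part after a quarter turn, that is \<open>T(\<phi> Y, Z) = 0\<close>\<close>
  have zero: "horizontal_form b (- a) p (Y p) (Z p) = 0" if "Y \<in> vfields A U" for Y
  proof -
    note vf = that vf(2)
    have T: "Y p \<in> tangent_space A p" "Z p \<in> tangent_space A p"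
      "D \<xi> Y p \<in> tangent_space A p" "D \<xi> Z p \<in> tangent_space A p"
      using vf p vfields_tangent D_tangent[OF U] xi_vfield by blast+
    let ?e = "\<lambda>q. \<eta> q (Y q) * \<eta> q (Z q)"
    have sm: "?e \<in> smooth_funs A U" "(\<lambda>q. \<eta> q (Y q)) \<in> smooth_funs A U"
      "(\<lambda>q. \<eta> q (Z q)) \<in> smooth_funs A U"
      using U vf by (auto intro!: smooth_funs_mult eta_smooth)
    have "dir (\<xi> p) (\<lambda>q. ricci A g D Y Z q) =
        dir (\<xi> p) (\<lambda>q. horizontal_form a b q (Y q) (Z q) + (a + b + c) * (\<eta> q (Y q) * \<eta> q (Z q)))"
      using ric vf by (intro dir_cong[OF xi_tangent U p]) simp
    also have "\<dots> = dir (\<xi> p) (\<lambda>q. horizontal_form a b q (Y q) (Z q)) + (a + b + c) * dir (\<xi> p) ?e"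
      using dir_plus[OF xi_tangent U p horizontal_form_smooth[OF U vf] smooth_funs_mult[OF U
        smooth_funs_const sm(1)]]
        dir_cmult[OF xi_tangent U p sm(1)] by simp
    also have "dir (\<xi> p) ?e = \<eta> p (D \<xi> Y p) * \<eta> p (Z p) + \<eta> p (Y p) * \<eta> p (D \<xi> Z p)"
      using dir_times[OF xi_tangent U p sm(2,3)] vf p T by (simp add: dir_eta[OF U xi_vfield])
    also have "dir (\<xi> p) (\<lambda>q. horizontal_form a b q (Y q) (Z q)) =
      horizontal_form a b p (D \<xi> Y p) (Z p) + horizontal_form a b p (Y p) (D \<xi> Z p)"
      using dir_horizontal_form[OF U xi_vfield vf p] T by simp
    finally have "horizontal_form a b p (\<phi> p (Y p)) (Z p) +
      horizontal_form a b p (Y p) (\<phi> p (Z p)) = 0"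
      using ricci_xi_invariant[OF U vf p] U vf p T
      by (simp add: ric bracket_xi[OF U] bracket_vfield[OF U] del: horizontal_form_phi_left)
        (simp add: algebra_simps)
    then show ?thesis
      using T horizontal_form_sym[of "Y p" p "\<phi> p (Z p)"] horizontal_form_sym[of "Y p" p "Z p"] by
        simp
  qed
  have "ricci A g D Y Z p = (a + b + c) * (\<eta> p (Y p) * \<eta> p (Z p))" 
    using zero[of "\<lambda>q. \<phi> q (Y q)"] U vf p vfields_tangent[OF vf(1) p] vfields_tangent[OF vf(2) p]
    by (simp add: ric horizontal_form_def algebra_simps)
  moreover have "a + b + c = 2 * real n"
    using ric[of \<xi> \<xi> p] ricci_xi_xi[of p] p by simp
  ultimately show ?thesis by simp
qed

end

section \<open>The associated metric\<close>

context sasaki_like_manifold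
begin

abbreviation "g' \<equiv> associated_metric \<phi> \<eta> g"

text \<open>
  Up to \<open>\<eta> \<otimes> \<eta>\<close> the associated metric is a horizontal form, so its derivatives are known.
\<close>

lemma assoc_metric_eq: "g' p x y = horizontal_form 0 1 p x y + \<eta> p x * \<eta> p y"
  by (simp add: associated_metric_def horizontal_form_def)

lemma assoc_xi [simp]: "x \<in> tangent_space A p \<Longrightarrow> g' p (\<xi> p) x = \<eta> p x"
  by (simp add: assoc_metric_eq)

lemma assoc_metric_field: "metric_field A g'"
proof
  show "symmetric_form A g'"
    unfolding symmetric_form_def
  proof (intro conjI allI ballI impI)
    fix p x y z c assume T: "x \<in> tangent_space A p" "y \<in> tangent_space A p" "z \<in> tangent_space A p"
    then show "g' p x y = g' p y x" by (simp add: assoc_metric_eq horizontal_form_sym)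
    show "g' p (x + y) z = g' p x z + g' p y z" "g' p (c *\<^sub>R x) z = c * g' p x z"
      using T by (simp_all add: associated_metric_def algebra_simps)
  next
    fix U X Y assume "open U" "X \<in> vfields A U" "Y \<in> vfields A U"
    then show "(\<lambda>p. g' p (X p) (Y p)) \<in> smooth_funs A U"
      unfolding assoc_metric_eq by (intro smooth_funs_add smooth_funs_mult horizontal_form_smooth
        eta_smooth)
  qed
  fix t p assume t: "t \<in> tangent_space A p" and z: "\<And>s. s \<in> tangent_space A p \<Longrightarrow> g' p t s = 0"
  have "\<eta> p t = 0" using z[of "\<xi> p"] t by (simp add: associated_metric_def)
  then have "g p (\<phi> p t) s = 0" if "s \<in> tangent_space A p" for s
    using z[OF that] t that by (simp add: associated_metric_def)
  then have "\<phi> p t = 0" using t by (intro nondeg[of _ p]) auto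
  then have "\<phi> p (\<phi> p t) = 0" using phi_scale[of 0 p 0] by simp
  with t \<open>\<eta> p t = 0\<close> show "t = 0" by simp
qed

text \<open>
  The right-hand side is torsion-free because the added tensor is symmetric, and it is compatible
  with the associated metric by \<open>dir_horizontal_form\<close> and \<open>dir_eta\<close>. For the difference \<open>E\<close> to \<open>D'\<close> the
  tensor \<open>g'(E(X, Y), Z)\<close> is therefore symmetric in \<open>X\<close>, \<open>Y\<close> and skew in \<open>Y\<close>, \<open>Z\<close>.
\<close>

lemma assoc_levi_civita:
  assumes D': "levi_civita A g' D'" and U: "open U"
    and vf: "X \<in> vfields A U" "Y \<in> vfields A U" and p: "p \<in> U"
  shows "D' X Y p = D X Y p + horizontal_form (-1) (-1) p (X p) (Y p) *\<^sub>R \<xi> p"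
proof -
  interpret assoc: metric_field A g' by (rule assoc_metric_field)
  interpret assoc: levi_civita_connection A g' D' by (rule assoc.levi_civita_connectionI[OF D'])
  obtain V x where Vx: "(V, x) \<in> A" "p \<in> V" by (rule chart_exists)
  define N where "N = U \<inter> V"
  have N: "open N" "N \<subseteq> V" "p \<in> N" using U Vx chart_open p by (auto simp: N_def)
  have vfN: "X \<in> vfields A N" "Y \<in> vfields A N" using vf vfields_subset by (auto simp: N_def)
  define E where "E X Y = D' X Y p - (D X Y p + horizontal_form (-1) (-1) p (X p) (Y p) *\<^sub>R \<xi> p)"
    for X Y
  have T: "D' X Y p \<in> tangent_space A p" "D X Y p \<in> tangent_space A p" "X p \<in> tangent_space A p"
    if "X \<in> vfields A N" "Y \<in> vfields A N" for X Y
    using vfields_tangent[OF assoc.D_vfield[OF N(1) that] N(3)] vfields_tangent[OF D_vfield[OF N(1)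
      that] N(3)]
      vfields_tangent[OF that(1) N(3)] .
  have ET: "E X Y \<in> tangent_space A p" if "X \<in> vfields A N" "Y \<in> vfields A N" for X Y
    unfolding E_def using T[OF that] by simp
  have "E X Y = 0"
  proof (rule assoc.nondeg[OF ET[OF vfN]])
    fix s assume "s \<in> tangent_space A p"
    then obtain Z where Z: "Z \<in> vfields A N" "Z p = s"
      using vfield_through[OF Vx(1) N(2,3)] by blast
    have "g' p (E X Y) (Z p) = 0"
    proof (rule symmetric_skew_zero[where S = "vfields A N" and B = "\<lambda>X Y Z. g' p (E X Y) (Z p)"])
      fix X Y Z assume vf: "X \<in> vfields A N" "Y \<in> vfields A N" "Z \<in> vfields A N"
      note T = T[OF vf(1,2)] T[OF vf(1,3)] T[OF vf(2,1)] T[OF vf(3,1)]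
      have "D' X Y p - D' Y X p = D X Y p - D Y X p"
        using torsion[OF N(1) vf(1,2) N(3)] assoc.torsion[OF N(1) vf(1,2) N(3)] by simp
      then have "E X Y = E Y X"
        using T by (simp add: E_def horizontal_form_sym[of "X p" p "Y p"] algebra_simps)
      then show "g' p (E X Y) (Z p) = g' p (E Y X) (Z p)" by simp
      have sm: "(\<lambda>q. \<eta> q (Y q)) \<in> smooth_funs A N" "(\<lambda>q. \<eta> q (Z q)) \<in> smooth_funs A N"
        using N vf by (auto intro!: eta_smooth)
      have "dir (X p) (\<lambda>q. g' q (Y q) (Z q)) =
          dir (X p) (\<lambda>q. horizontal_form 0 1 q (Y q) (Z q)) + (dir (X p) (\<lambda>q. \<eta> q (Y q)) * \<eta> p (Z p)
            + \<eta> p (Y p) * dir (X p) (\<lambda>q. \<eta> q (Z q)))"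
        unfolding assoc_metric_eq
        using dir_plus[OF T(3) N(1,3) horizontal_form_smooth[OF N(1) vf(2,3)] smooth_funs_mult[OF
          N(1) sm]]
          dir_times[OF T(3) N(1,3) sm] by simp
      then have "g' p (D' X Y p) (Z p) + g' p (Y p) (D' X Z p) = g' p (D X Y p) (Z p) +
        g' p (Y p) (D X Z p)
        + \<eta> p (Y p) * horizontal_form (-1) 0 p (X p) (Z p) +
          \<eta> p (Z p) * horizontal_form (-1) 0 p (X p) (Y p)
        - g p (X p) (\<phi> p (Y p)) * \<eta> p (Z p) - \<eta> p (Y p) * g p (X p) (\<phi> p (Z p))"
        unfolding assoc.compat[OF N(1) vf(2,3,1) N(3)] dir_horizontal_form[OF N(1) vf N(3)]
          dir_eta[OF N(1) vf(1,2) N(3)] dir_eta[OF N(1) vf(1,3) N(3)]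
        by (simp add: assoc_metric_eq algebra_simps)
      then have "g' p (E X Y) (Z p) + g' p (Y p) (E X Z) = 0"
        using T assoc.form_sym[of "Y p" p "\<xi> p"] by
          (simp add: E_def horizontal_form_def algebra_simps)
      then show "g' p (E X Y) (Z p) = - g' p (E X Z) (Y p)"
        using T ET[OF vf(1,3)] assoc.form_sym[of "Y p" p "E X Z"] by simp
    qed (use vfN Z in auto)
    then show "g' p (E X Y) s = 0" using Z by simp
  qed
  then show ?thesis by (simp add: E_def)
qed

text \<open>
  The quadratic terms are multiples of \<open>T(X, \<xi>)\<close> and vanish.
\<close>

lemma assoc_curv:
  assumes D': "levi_civita A g' D'" and U: "open U"
    and vf: "X \<in> vfields A U" "Y \<in> vfields A U" "Z \<in> vfields A U" and p: "p \<in> U"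
  shows "curv A D' X Y Z p = curv A D X Y Z p + curv_variation (-1) (-1) X Y Z p"
proof -
  interpret assoc: metric_field A g' by (rule assoc_metric_field)
  interpret assoc: levi_civita_connection A g' D' by (rule assoc.levi_civita_connectionI[OF D'])
  let ?T = "horizontal_form (-1) (-1)"
  note eq = assoc_levi_civita[OF D' U]
  have two: "D' X (D' Y Z) p = D X (D Y Z) p + D X (\<lambda>q. ?T q (Y q) (Z q) *\<^sub>R \<xi> q) p +
    ?T p (X p) (D Y Z p) *\<^sub>R \<xi> p"
    if "X \<in> vfields A U" "Y \<in> vfields A U" for X Y
  proof -
    have T: "X p \<in> tangent_space A p" "D Y Z p \<in> tangent_space A p"
      using vfields_tangent[OF that(1) p] vfields_tangent[OF D_vfield[OF U that(2) vf(3)] p] .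
    have "D X (D' Y Z) p = D X (\<lambda>q. D Y Z q + ?T q (Y q) (Z q) *\<^sub>R \<xi> q) p"
      by (intro D_cong_right[OF U] that assoc.D_vfield[OF U] vfields_add D_vfield[OF U]
        horizontal_form_xi_vfield[OF U] vf p eq)
    also have "\<dots> = D X (D Y Z) p + D X (\<lambda>q. ?T q (Y q) (Z q) *\<^sub>R \<xi> q) p"
      by (intro D_add_right[OF U] that D_vfield[OF U] horizontal_form_xi_vfield[OF U] vf p)
    finally have "D X (D' Y Z) p = \<dots>" .
    moreover have "?T p (X p) (\<xi> p) = 0" using T horizontal_form_sym[of "X p" p "\<xi> p"] by simp
    then have "?T p (X p) (D' Y Z p) = ?T p (X p) (D Y Z p)"
      using T by (simp add: eq[OF that(2) vf(3) p]) (simp add: horizontal_form_def)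
    ultimately show ?thesis
      using eq[OF that(1) assoc.D_vfield[OF U that(2) vf(3)] p] by simp
  qed
  have "D' (lie_bracket A X Y) Z p = D (lie_bracket A X Y) Z p +
    ?T p (lie_bracket A X Y p) (Z p) *\<^sub>R \<xi> p"
    by (intro eq bracket_vfield[OF U] vf p)
  then show ?thesis
    by (simp add: curv_def two[OF vf(1,2)] two[OF vf(2,1)] curv_variation_def algebra_simps)
qed

lemma assoc_ricci:
  assumes D': "levi_civita A g' D'" and U: "open U" and vf: "Y \<in> vfields A U" "Z \<in> vfields A U"
    and p: "p \<in> U"
  shows "ricci A g' D' Y Z p = ricci A g D Y Z p"
proof -
  interpret assoc: metric_field A g' by (rule assoc_metric_field)
  interpret assoc: levi_civita_connection A g' D' by (rule assoc.levi_civita_connectionI[OF D'])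
  obtain V x where Vx: "(V, x) \<in> A" "p \<in> V" by (rule chart_exists)
  define N where "N = U \<inter> V"
  have N: "open N" "N \<subseteq> V" "p \<in> N" using U Vx chart_open p by (auto simp: N_def)
  have vfN: "Y \<in> vfields A N" "Z \<in> vfields A N" using vf vfields_subset by (auto simp: N_def)
  have e: "coord_frame V x k \<in> vfields A N" for k by (rule coord_frame_vfield[OF Vx(1) N(2)])
  show ?thesis
    unfolding assoc.ricci_trace[OF assoc_metric_field N(1,3) vfN Vx] ricci_trace[OF
      metric_field_axioms N(1,3) vfN Vx]
    by (simp add: assoc_curv[OF D' N(1) e vfN N(3)] sum.distrib trace_curv_variation[OF Vx(1) N
      vfN])
qed

end

theorem theorem3p3:
  fixes n :: nat
    and A :: "('m::{t2_space, second_countable_topology}, 'd::finite) atlas"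
    and \<phi> :: "'m \<Rightarrow> 'm tvec \<Rightarrow> 'm tvec"
    and \<xi> :: "'m vfield"
    and \<eta> :: "'m \<Rightarrow> 'm tvec \<Rightarrow> real"
    and g :: "'m \<Rightarrow> 'm tvec \<Rightarrow> 'm tvec \<Rightarrow> real"
    and D D' :: "'m vfield \<Rightarrow> 'm vfield \<Rightarrow> 'm vfield"
    and v :: "'m vfield"
  assumes "almost_contact_B_metric n A \<phi> \<xi> \<eta> g"
    and "levi_civita A g D"
    and "levi_civita A (associated_metric \<phi> \<eta> g) D'"
    and "sasaki_like A \<phi> \<xi> \<eta> g D"
    and "einstein_like A \<phi> \<eta> g D"
    and "v \<in> vfields A UNIV"
    and "ricci_like_soliton A \<phi> \<eta> g D v"
  shows "(\<forall>U. open U \<longrightarrow> (\<forall>X\<in>vfields A U. \<forall>Y\<in>vfields A U. \<forall>p\<in>U.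
            ricci A g D X Y p = 2 * real n * \<eta> p (X p) * \<eta> p (Y p)))
       \<and> (\<forall>p. scalar_curv A g D p = 2 * real n
            \<and> scalar_curv A (associated_metric \<phi> \<eta> g) D' p = 2 * real n)"
proof -
  interpret sasaki_like_manifold n A \<phi> \<xi> \<eta> g D
    using assms by unfold_locales
  interpret assoc: metric_field A "associated_metric \<phi> \<eta> g" by (rule assoc_metric_field)
  note ric = einstein_like_ricci[OF assms(5)]
  show ?thesis
  proof (intro conjI allI impI ballI)
    show "scalar_curv A g D p = 2 * real n" for p
      by (rule scalar_curv_eta_square[where \<xi> = "\<xi> p" and \<eta> = "\<eta> p"]) (simp_all add: ric)
    show "scalar_curv A (associated_metric \<phi> \<eta> g) D' p = 2 * real n" for p
      by (rule assoc.scalar_curv_eta_square[where \<xi> = "\<xi> p" and \<eta> = "\<eta> p"])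
        (simp_all add: assoc_ricci[OF assms(3)] ric)
  qed (rule ric)
qed

end
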